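(* Let $\delta\in(0,1)$ and $m\in\mathbb{N}$. The estimator $\widehat{t}_{\mathsf{mix}}\colon\mathcal{X}^m\to\mathbb{N}$ defined in the context is such that for any unknown ergodic Markov chain with transition matrix $P$, minimum stationary probability $\pi_\star$ and mixing time $t_{\mathsf{mix}}$, $X^m=X_1,X_2,\dots,X_m\sim(\mu,P)$, if $$m\ge c\max\left\{\Xi(P),\ \frac{t_{\mathsf{mix}}}{\pi_\star}\log\frac{\log t_{\mathsf{mix}}}{\delta\pi_\star}\right\},$$ then $$\max\left\{\frac{\widehat{t}_{\mathsf{mix}}}{t_{\mathsf{mix}}},\frac{t_{\mathsf{mix}}}{\widehat{t}_{\mathsf{mix}}}\right\}\le\sqrt{\frac{\overline{c}}{\underline{c}}}\;4\sqrt{\log(4e)}$$ holds with probability at least $1-\delta$, where $c>0$ is a universal constant.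
   Context: $\mathbb{N}=\{1,2,\dots\}$, $[n]=\{1,\dots,n\}$, $\log$ is the natural logarithm, and $s$ ranges over $\mathbb{N}$. A row-stochastic matrix $P$ over a finite set $\mathcal{X}$ is ergodic if it is primitive; $\pi$ is its stationary distribution and $\pi_\star=\min_x\pi(x)$. $X^m\sim(\mu,P)$ means a trajectory of length $m$ of the Markov chain with initial distribution $\mu$ (a probability distribution on $\mathcal{X}$) and transition matrix $P$. $\|\mu-\nu\|_{\mathsf{TV}}=\frac12\sum_x|\mu(x)-\nu(x)|$; the mixing time $t_{\mathsf{mix}}$ is the smallest $t\in\mathbb{N}$ with $\sup_\mu\|\mu P^t-\pi\|_{\mathsf{TV}}<1/4$. For a stochastic matrix $Q$, $\kappa(Q)=\max_{\mu,\nu}\|\mu Q-\nu Q\|_{\mathsf{TV}}$ over pairs of probability distributions. The generalized contraction coefficient is $\kappa_\star=\kappa_\star(P)=1-\max_{s\in\mathbb{N}}\{(1-\kappa(P^s))/s\}$. The constants $\underline c\ge1/2$ and $\overline c\le\log(4e)=2.38629\dots$ are universal constants (known to exist) such that $\frac{\underline c}{1-\kappa_\star}\le t_{\mathsf{mix}}\le\frac{\overline c}{1-\kappa_\star}$ for every ergodic transition matrix. For an ergodic $Q$ with stationary distribution $\pi$, $\Gamma(Q)=\max_{x}\frac{\|e_xQ\|_{1/2}}{\pi(x)}$, where $e_xQ$ is the row of $Q$ at $x$ and $\|v\|_{1/2}=\left(\sum_x\sqrt{|v(x)|}\right)^2$ (the powers of $P$ have the same stationary distribution as $P$). With $\overline{p}=\lceil\log_2t_{\mathsf{mix}}\rceil$,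 $$\Xi(P)=\max_{p\in\{0,1,\dots,\overline{p}\}}\left\{2^p\max_{s\le16}\left\{\frac{\Gamma(P^{s2^p})}{s}\right\}\right\}.$$ Estimator. Let $\lambda\in(0,\infty)^{\mathcal{X}}$ be a fixed smoothing vector. For a sequence $Y^n=Y_1,\dots,Y_n$ in $\mathcal{X}$, let $N_x=\sum_{t=1}^{n-1}\mathbf{1}\{Y_t=x\}$, $N_{xx'}=\sum_{t=1}^{n-1}\mathbf{1}\{Y_t=x,Y_{t+1}=x'\}$, and let $\widehat{P}_\lambda(Y^n)$ be the matrix with entries $\frac{N_{xx'}+\lambda(x)}{N_x+\lambda(x)|\mathcal{X}|}$. For $r\in\mathbb{N}$, $Y^n_{[r]}=Y_1,Y_{1+r},\dots,Y_{1+\lfloor(n-1)/r\rfloor r}$ is the $r$-skipped sequence. Let $\epsilon=(\sqrt2-1)/4$ and $$\widehat{\kappa}_\star^+(Y^n)=1-\max_{r\in[\lceil2/\epsilon\rceil]}\left\{\frac{1-\kappa(\widehat{P}_\lambda(Y^n_{[r]}))}{r}\right\}.$$ For $s\in\mathbb{N}$ let $\widehat{\kappa}_\star^{(s)}=\widehat{\kappa}_\star^+(X^m_{[s]})$, an estimator of $\kappa_\star(P^s)$ computed from the $s$-skipped trajectory with target additive precision $\epsilon$. Let $S$ be the random skipping rate such that $\log_2S$ is the smallest $p\in\{0,1,2,\dots\}$ with $1-\widehat{\kappa}_\star^{(2^p)}>\frac{\sqrt2}{4}$, and $$\widehat{\kappa}_\star^\times(X^m)=1-\frac{1-\widehat{\kappa}_\star^{(S)}}{\sqrt{c_\star}\,S},\quad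 c_\star=\frac1{4\log(4e)},\qquad\widehat{t}_{\mathsf{mix}}(X^m)=\frac{\sqrt{\overline{c}\,\underline{c}}}{1-\widehat{\kappa}_\star^\times(X^m)}.$$
   Formalization: The constant c may depend on an upper bound for the smoothing mass max λ(x)|X| (no c works for all λ), and when t_mix = 1, where log log t_mix is undefined, the inner log t_mix is replaced by 1. *)

theory Defs
  imports "HOL-Probability.Probability" "Jordan_Normal_Form.Matrix"
begin

unbundle no vec_syntax

(* A finite state space with d states is identified with {..<d}.  Distributions on it are
   elements of carrier_vec d, and a kernel is an element of carrier_mat d d with rows indexed
   by the current state. *)

definition prob_simplex :: "nat \<Rightarrow> real vec set" where
  "prob_simplex d = {v \<in> carrier_vec d. (\<forall>i<d. 0 \<le> v $ i) \<and> (\<Sum>i<d. v $ i) = 1}"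

definition row_stochastic :: "nat \<Rightarrow> real mat \<Rightarrow> bool" where
  "row_stochastic d P \<longleftrightarrow> P \<in> carrier_mat d d \<and> (\<forall>x<d. row P x \<in> prob_simplex d)"

definition primitive_mat :: "nat \<Rightarrow> real mat \<Rightarrow> bool" where
  "primitive_mat d P \<longleftrightarrow> (\<exists>k\<ge>1. \<forall>x<d. \<forall>y<d. 0 < (P ^\<^sub>m k) $$ (x, y))"

definition ergodic :: "nat \<Rightarrow> real mat \<Rightarrow> bool" where
  "ergodic d P \<longleftrightarrow> 0 < d \<and> row_stochastic d P \<and> primitive_mat d P"

(* The product of a row vector (from the left) with a matrix. *)
definition push :: "real vec \<Rightarrow> real mat \<Rightarrow> real vec" where
  "push v Q = transpose_mat Q *\<^sub>v v"

(* The description is proper for ergodic P, hence also for the powers of an ergodic matrix. *)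
definition stationary :: "real mat \<Rightarrow> real vec" where
  "stationary P = (THE v. v \<in> prob_simplex (dim_row P) \<and> push v P = v)"

definition pi_min :: "real mat \<Rightarrow> real" where
  "pi_min P = (MIN x\<in>{..<dim_row P}. stationary P $ x)"

definition tv_dist :: "real vec \<Rightarrow> real vec \<Rightarrow> real" where
  "tv_dist u v = (1/2) * (\<Sum>i<dim_vec u. \<bar>u $ i - v $ i\<bar>)"

definition t_mix :: "real mat \<Rightarrow> nat" where
  "t_mix P = (LEAST t. 1 \<le> t \<and>
     (SUP v\<in>prob_simplex (dim_row P). tv_dist (push v (P ^\<^sub>m t)) (stationary P)) < 1/4)"

definition kappa :: "real mat \<Rightarrow> real" where
  "kappa Q = (SUP (u, v)\<in>prob_simplex (dim_row Q) \<times> prob_simplex (dim_row Q).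
     tv_dist (push u Q) (push v Q))"

definition kappa_star :: "real mat \<Rightarrow> real" where
  "kappa_star P = 1 - (SUP s\<in>{1::nat..}. (1 - kappa (P ^\<^sub>m s)) / real s)"

definition half_norm :: "real vec \<Rightarrow> real" where
  "half_norm v = (\<Sum>i<dim_vec v. sqrt \<bar>v $ i\<bar>)\<^sup>2"

definition Gamma_mat :: "real mat \<Rightarrow> real" where
  "Gamma_mat Q = (MAX x\<in>{..<dim_row Q}. half_norm (row Q x) / stationary Q $ x)"

definition Xi :: "real mat \<Rightarrow> real" where
  "Xi P = (MAX p\<in>{0..nat \<lceil>log 2 (real (t_mix P))\<rceil>}.
     2 ^ p * (MAX s\<in>{1..16}. Gamma_mat (P ^\<^sub>m (s * 2 ^ p)) / real s))"

(* The factor "log t_mix" inside the iterated logarithm of the trajectory-length condition.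
   It is the logarithm whenever t_mix \<ge> 2.  At t_mix = 1 the iterated logarithm is undefined;
   the value 1 makes the term there equal to log (1 / (delta * pi_min)). *)
definition log_t_mix :: "real mat \<Rightarrow> real" where
  "log_t_mix P = (if t_mix P = 1 then 1 else ln (real (t_mix P)))"

definition vec_pmf :: "real vec \<Rightarrow> nat pmf" where
  "vec_pmf v = embed_pmf (\<lambda>i. if i < dim_vec v then v $ i else 0)"

(* The law of the trajectory of length m, as a list of states. *)
fun markov_path :: "real vec \<Rightarrow> real mat \<Rightarrow> nat \<Rightarrow> nat list pmf" where
  "markov_path \<mu> P 0 = return_pmf []"
| "markov_path \<mu> P (Suc m) =
     bind_pmf (vec_pmf \<mu>) (\<lambda>x. map_pmf (Cons x) (markov_path (row P x) P m))"

(* Positions in lists start at 0, so that the t-th observation Y_t is Y ! (t - 1). *)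

definition visits :: "nat list \<Rightarrow> nat \<Rightarrow> nat" where
  "visits Y x = card {t. t + 1 < length Y \<and> Y ! t = x}"

definition transitions :: "nat list \<Rightarrow> nat \<Rightarrow> nat \<Rightarrow> nat" where
  "transitions Y x x' = card {t. t + 1 < length Y \<and> Y ! t = x \<and> Y ! (t + 1) = x'}"

definition P_hat :: "real vec \<Rightarrow> nat list \<Rightarrow> real mat" where
  "P_hat lam Y = mat (dim_vec lam) (dim_vec lam) (\<lambda>(x, x').
     (real (transitions Y x x') + lam $ x) / (real (visits Y x) + lam $ x * real (dim_vec lam)))"

(* For a nonempty list. *)
definition skipped :: "nat \<Rightarrow> nat list \<Rightarrow> nat list" where
  "skipped r Y = map (\<lambda>i. Y ! (i * r)) [0..<(length Y - 1) div r + 1]"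

definition eps0 :: real where
  "eps0 = (sqrt 2 - 1) / 4"

definition kappa_hat_plus :: "real vec \<Rightarrow> nat list \<Rightarrow> real" where
  "kappa_hat_plus lam Y =
     1 - (MAX r\<in>{1..nat \<lceil>2 / eps0\<rceil>}. (1 - kappa (P_hat lam (skipped r Y))) / real r)"

definition kappa_hat_skip :: "real vec \<Rightarrow> nat \<Rightarrow> nat list \<Rightarrow> real" where
  "kappa_hat_skip lam s X = kappa_hat_plus lam (skipped s X)"

(* A suitable p exists for every nonempty list: once 2 ^ p \<ge> length X, the skipped list has
   a single entry, P_hat is the uniform kernel and kappa_hat_skip is 0. *)
definition skip_rate :: "real vec \<Rightarrow> nat list \<Rightarrow> nat" where
  "skip_rate lam X = 2 ^ (LEAST p. 1 - kappa_hat_skip lam (2 ^ p) X > sqrt 2 / 4)"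

definition c_star :: real where
  "c_star = 1 / (4 * ln (4 * exp 1))"

definition kappa_hat_times :: "real vec \<Rightarrow> nat list \<Rightarrow> real" where
  "kappa_hat_times lam X =
     1 - (1 - kappa_hat_skip lam (skip_rate lam X) X) / (sqrt c_star * real (skip_rate lam X))"

definition t_mix_hat :: "real \<Rightarrow> real \<Rightarrow> real vec \<Rightarrow> nat list \<Rightarrow> real" where
  "t_mix_hat c_lo c_hi lam X = sqrt (c_hi * c_lo) / (1 - kappa_hat_times lam X)"

(* c_lo and c_hi are constants relating the mixing time to the generalized contraction
   coefficient, uniformly over all finite state spaces. *)
definition mixing_constants :: "real \<Rightarrow> real \<Rightarrow> bool" where
  "mixing_constants c_lo c_hi \<longleftrightarrow> 1/2 \<le> c_lo \<and> c_hi \<le> ln (4 * exp 1) \<and>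
     (\<forall>d P. ergodic d P \<longrightarrow>
        c_lo / (1 - kappa_star P) \<le> real (t_mix P) \<and>
        real (t_mix P) \<le> c_hi / (1 - kappa_star P))"

end

theory Submission
  imports Defs
begin

text \<open>Since \<open>1/3 < sqrt 2 / 4\<close>, the estimator only depends on the contraction coefficients of the
  empirical kernels at the skipping rates \<open>s = 2 ^ q\<close>, and a constant additive error on these suffices
  for all \<open>q \<le> \<lceil>log 2 t_mix\<rceil> + 1\<close>. For one skipped chain \<open>Q = P\<^sup>s\<close>, all the probability is in one
  fact: if \<open>\<Sum>y. Q x y * h x y \<le> 1\<close> for all \<open>x\<close>, then the product of \<open>h\<close> along the trajectory has
  expectation at most 1. With \<open>h\<close> built from a truncated solution of the Poisson equation this bounds
  the probability that a state is visited rarely, from any initial distribution and without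
  reversibility. With exponentials of centred transition indicators it bounds the deviation
  of the empirical mass of a set of states. A union bound over the subsets of the at most
  \<open>half_norm (row Q x) / \<eta>\<close> heavy states of each row then controls the rows in total variation.\<close>

section \<open>Total variation and contraction\<close>

text \<open>The tolerance 1/8 is chosen for both directions. At rate
  \<open>2 ^ \<lceil>log 2 t_mix\<rceil>\<close> the true coefficient is at most 1/2, so 3/8 > sqrt
  2 / 4 survives the error and the search stops there at the latest. Conversely, an accepted value
  exceeds 1/4, so the error is at most half of it, and the rest bounds
  \<open>1 - kappa_star P\<close> from below through its defining supremum. Rates far beyond
  \<open>t_mix\<close>, at which too few observations remain, are thus never inspected. Of the union
  bounds, those over scales (about \<open>log t_mix\<close> of them) and over states (at most
  \<open>1 / pi_min\<close>) make up the logarithm in the length condition. The one over sets of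
  heavy states adds \<open>half_norm\<close> to the exponent, and this is why \<open>Xi\<close>
  stands beside the logarithmic term and does not multiply it. A single state is treated apart,
  because the logarithm then tends to 0 as \<delta> tends to 1.\<close>

lemma prob_simplexD:
  assumes "v \<in> prob_simplex d"
  shows "v \<in> carrier_vec d" "dim_vec v = d" "\<And>i. i < d \<Longrightarrow> 0 \<le> v $ i" "(\<Sum>i<d. v $ i) = 1"
  using assms by (auto simp: prob_simplex_def)

lemma row_stochasticD:
  assumes "row_stochastic d Q"
  shows "Q \<in> carrier_mat d d" "dim_row Q = d" "dim_col Q = d"
    "\<And>x y. x < d \<Longrightarrow> y < d \<Longrightarrow> 0 \<le> Q $$ (x, y)"
    "\<And>x. x < d \<Longrightarrow> (\<Sum>y<d. Q $$ (x, y)) = 1"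
    "\<And>x. x < d \<Longrightarrow> row Q x \<in> prob_simplex d"
proof -
  show c: "Q \<in> carrier_mat d d" "dim_row Q = d" "dim_col Q = d"
    using assms by (auto simp: row_stochastic_def)
  show r: "row Q x \<in> prob_simplex d" if "x < d" for x
    using assms that by (auto simp: row_stochastic_def)
  show "0 \<le> Q $$ (x, y)" if "x < d" "y < d" for x y
    using prob_simplexD(3)[OF r[OF that(1)] that(2)] that c by simp
  show "(\<Sum>y<d. Q $$ (x, y)) = 1" if "x < d" for x
    using prob_simplexD(4)[OF r[OF that]] that c by simp
qed

lemma row_stochasticI:
  assumes "Q \<in> carrier_mat d d" "\<And>x y. x < d \<Longrightarrow> y < d \<Longrightarrow> 0 \<le> Q $$ (x, y)"
    "\<And>x. x < d \<Longrightarrow> (\<Sum>y<d. Q $$ (x, y)) = 1"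
  shows "row_stochastic d Q"
  unfolding row_stochastic_def prob_simplex_def using assms(1)
  by (auto simp: assms(2,3))

section \<open>Distributions pushed through kernels and their powers\<close>

lemma push_carrier: "Q \<in> carrier_mat d d \<Longrightarrow> push v Q \<in> carrier_vec d"
  by (intro carrier_vecI) (simp add: push_def)

lemma push_index:
  assumes "v \<in> carrier_vec d" "Q \<in> carrier_mat d d" "j < d"
  shows "push v Q $ j = (\<Sum>i<d. v $ i * Q $$ (i, j))"
  using assms by (auto simp: push_def scalar_prod_def mult.commute atLeast0LessThan intro!: sum.cong)

lemma push_one: "v \<in> carrier_vec d \<Longrightarrow> push v (1\<^sub>m d) = v"
  by (simp add: push_def transpose_one)

lemma push_mult:
  assumes "v \<in> carrier_vec d" "A \<in> carrier_mat d d" "B \<in> carrier_mat d d"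
  shows "push v (A * B) = push (push v A) B"
  using assms by (simp add: push_def transpose_mult[of A d d B d])

lemma pow_mat_add:
  fixes A :: "real mat"
  assumes "A \<in> carrier_mat d d"
  shows "A ^\<^sub>m (a + b) = A ^\<^sub>m a * A ^\<^sub>m b"
proof (induction b)
  case 0
  then show ?case using assms by (simp add: right_mult_one_mat[of _ d])
next
  case (Suc b)
  then show ?case using assms by (simp add: assoc_mult_mat[of _ d d _ d _ d])
qed

lemma pow_mat_mult:
  fixes A :: "real mat"
  assumes "A \<in> carrier_mat d d"
  shows "A ^\<^sub>m (a * b) = (A ^\<^sub>m a) ^\<^sub>m b"
proof (induction b)
  case 0
  then show ?case using assms by simp
next
  case (Suc b)
  have "A ^\<^sub>m (a * Suc b) = A ^\<^sub>m (a * b) * A ^\<^sub>m a"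
    using pow_mat_add[OF assms, of "a * b" a] by (simp add: add.commute)
  then show ?case using Suc by simp
qed

lemma push_pow_add:
  assumes "v \<in> carrier_vec d" "P \<in> carrier_mat d d"
  shows "push v (P ^\<^sub>m (a + b)) = push (push v (P ^\<^sub>m a)) (P ^\<^sub>m b)"
  using assms by (simp add: pow_mat_add push_mult[of _ d])

lemma push_simplex:
  assumes Q: "row_stochastic d Q" and v: "v \<in> prob_simplex d"
  shows "push v Q \<in> prob_simplex d"
proof -
  note q = row_stochasticD[OF Q] and s = prob_simplexD[OF v]
  have "(\<Sum>j<d. push v Q $ j) = (\<Sum>j<d. \<Sum>i<d. v $ i * Q $$ (i, j))"
    using q s by (intro sum.cong) (auto simp: push_index)
  also have "\<dots> = (\<Sum>i<d. v $ i * (\<Sum>j<d. Q $$ (i, j)))"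
    by (subst sum.swap) (simp add: sum_distrib_left)
  also have "\<dots> = 1" using q s by simp
  finally have "(\<Sum>j<d. push v Q $ j) = 1" .
  moreover have "0 \<le> push v Q $ j" if "j < d" for j
    using that q s by (auto simp: push_index intro!: sum_nonneg)
  ultimately show ?thesis using push_carrier[OF q(1)] by (simp add: prob_simplex_def)
qed

lemma unit_vec_simplex: "x < d \<Longrightarrow> unit_vec d x \<in> prob_simplex d"
  by (auto simp: prob_simplex_def unit_vec_def sum.delta)

lemma push_unit_vec:
  assumes "Q \<in> carrier_mat d d" "x < d"
  shows "push (unit_vec d x) Q = row Q x"
proof (rule eq_vecI)
  fix j assume "j < dim_vec (row Q x)"
  then have j: "j < d" using assms by simp
  have "push (unit_vec d x) Q $ j = (\<Sum>i<d. unit_vec d x $ i * Q $$ (i, j))"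
    using push_index[OF _ assms(1) j, of "unit_vec d x"] by simp
  also have "\<dots> = (\<Sum>i<d. if i = x then Q $$ (i, j) else 0)"
    using assms by (intro sum.cong) (auto simp: unit_vec_def)
  also have "\<dots> = row Q x $ j" using assms j by (simp add: sum.delta)
  finally show "push (unit_vec d x) Q $ j = row Q x $ j" .
next
  show "dim_vec (push (unit_vec d x) Q) = dim_vec (row Q x)"
    using assms push_carrier[OF assms(1), of "unit_vec d x"] by simp
qed

lemma row_mult_eq_push:
  assumes "A \<in> carrier_mat d d" "B \<in> carrier_mat d d" "x < d"
  shows "row (A * B) x = push (row A x) B"
  using assms push_unit_vec[of A d x] push_unit_vec[of "A * B" d x] push_mult[of "unit_vec d x" d A B]
  by simp

lemma row_stochastic_one: "row_stochastic d (1\<^sub>m d)"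
  by (auto simp: row_stochastic_def unit_vec_simplex)

lemma row_stochastic_mult:
  assumes "row_stochastic d A" "row_stochastic d B"
  shows "row_stochastic d (A * B)"
  using assms row_stochasticD[OF assms(1)] row_stochasticD[OF assms(2)]
  by (auto simp: row_stochastic_def row_mult_eq_push simp del: row_mult intro!: push_simplex)

lemma row_stochastic_pow: "row_stochastic d P \<Longrightarrow> row_stochastic d (P ^\<^sub>m k)"
  by (induction k) (auto simp: row_stochastic_one row_stochasticD row_stochastic_mult)

section \<open>Total variation distance\<close>

lemma tv_simplex:
  "u \<in> prob_simplex d \<Longrightarrow> tv_dist u v = (\<Sum>i<d. \<bar>u $ i - v $ i\<bar>) / 2"
  by (simp add: tv_dist_def prob_simplexD)

text \<open>Both masses are 1, so the positive and negative parts of \<open>u - v\<close> have equal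
  sums.\<close>

lemma tv_pos_part:
  assumes u: "u \<in> prob_simplex d" and v: "v \<in> prob_simplex d"
  shows "tv_dist u v = (\<Sum>i<d. max 0 (u $ i - v $ i))"
proof -
  have "(\<Sum>i<d. \<bar>u $ i - v $ i\<bar>) = (\<Sum>i<d. 2 * max 0 (u $ i - v $ i) - (u $ i - v $ i))"
    by (intro sum.cong) (auto simp: max_def abs_if)
  also have "\<dots> = 2 * (\<Sum>i<d. max 0 (u $ i - v $ i))"
    using prob_simplexD(4)[OF u] prob_simplexD(4)[OF v]
    by (simp add: sum_subtractf sum_distrib_left)
  finally show ?thesis using tv_simplex[OF u, of v] by simp
qed

lemma tv_nonneg: "0 \<le> tv_dist u v"
  by (simp add: tv_dist_def sum_nonneg)

lemma tv_sym: "dim_vec u = dim_vec v \<Longrightarrow> tv_dist u v = tv_dist v u"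
  by (simp add: tv_dist_def abs_minus_commute)

lemma tv_triangle: "dim_vec u = dim_vec v \<Longrightarrow> tv_dist u w \<le> tv_dist u v + tv_dist v w"
  unfolding tv_dist_def
  by (simp add: distrib_left[symmetric] sum.distrib[symmetric] sum_mono)

lemma tv_le_1:
  assumes u: "u \<in> prob_simplex d" and v: "v \<in> prob_simplex d"
  shows "tv_dist u v \<le> 1"
proof -
  have "tv_dist u v \<le> (\<Sum>i<d. u $ i)"
    unfolding tv_pos_part[OF u v] using prob_simplexD[OF u] prob_simplexD[OF v]
    by (intro sum_mono) auto
  then show ?thesis using prob_simplexD[OF u] by simp
qed

lemma abs_diff_le_tv:
  assumes u: "u \<in> prob_simplex d" and "x < d"
  shows "\<bar>u $ x - v $ x\<bar> \<le> 2 * tv_dist u v"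
  unfolding tv_simplex[OF u] using assms by (auto intro!: member_le_sum)

text \<open>The common mass of \<open>u\<close> and \<open>v\<close> cancels under the linear map
  \<open>push\<close>. The positive and negative parts of \<open>u - v\<close> become distributions
  after division by \<open>tv_dist u v\<close>, and the uniform bound \<open>K\<close> applies to
  that pair.\<close>

lemma tv_push_scaled:
  assumes Q: "row_stochastic d Q" and u: "u \<in> prob_simplex d" and v: "v \<in> prob_simplex d"
    and K: "\<And>u v. u \<in> prob_simplex d \<Longrightarrow> v \<in> prob_simplex d \<Longrightarrow> tv_dist (push u Q) (push v Q) \<le> K"
  shows "tv_dist (push u Q) (push v Q) \<le> K * tv_dist u v"
proof (cases "tv_dist u v = 0")
  case True
  then have "u = v"
    using abs_diff_le_tv[OF u, of _ v] prob_simplexD[OF u] prob_simplexD[OF v]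
    by (intro eq_vecI) (auto simp: abs_le_zero_iff)
  then show ?thesis using True by (simp add: tv_dist_def)
next
  case False
  define D where "D = tv_dist u v"
  have D: "D > 0" using False tv_nonneg[of u v] by (simp add: D_def)
  have dims: "dim_vec u = d" "dim_vec v = d" using prob_simplexD u v by auto
  define u' where "u' = vec d (\<lambda>i. max 0 (u $ i - v $ i) / D)"
  define v' where "v' = vec d (\<lambda>i. max 0 (v $ i - u $ i) / D)"
  have u': "u' \<in> prob_simplex d" using D tv_pos_part[OF u v]
    by (auto simp: prob_simplex_def u'_def D_def sum_divide_distrib[symmetric])
  have v': "v' \<in> prob_simplex d" using D tv_pos_part[OF v u] tv_sym[of u v] dims
    by (auto simp: prob_simplex_def v'_def D_def sum_divide_distrib[symmetric])
  note q = row_stochasticD[OF Q]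
  have "push u Q $ j - push v Q $ j = D * (push u' Q $ j - push v' Q $ j)" if j: "j < d" for j
  proof -
    have "D * (push u' Q $ j - push v' Q $ j) = (\<Sum>i<d. D * (u' $ i - v' $ i) * Q $$ (i, j))"
      using push_index[OF prob_simplexD(1)[OF u'] q(1) j] push_index[OF prob_simplexD(1)[OF v'] q(1) j]
      by (simp add: sum_subtractf sum_distrib_left left_diff_distrib right_diff_distrib mult.assoc)
    also have "\<dots> = (\<Sum>i<d. (u $ i - v $ i) * Q $$ (i, j))"
      using D by (intro sum.cong) (auto simp: u'_def v'_def max_def field_simps)
    also have "\<dots> = push u Q $ j - push v Q $ j"
      using push_index[OF prob_simplexD(1)[OF u] q(1) j] push_index[OF prob_simplexD(1)[OF v] q(1) j]
      by (simp add: sum_subtractf left_diff_distrib)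
    finally show ?thesis by simp
  qed
  then have "tv_dist (push u Q) (push v Q) = D * tv_dist (push u' Q) (push v' Q)"
    using D
    by (simp add: tv_simplex[OF push_simplex[OF Q u], of "push v Q"]
        tv_simplex[OF push_simplex[OF Q u'], of "push v' Q"] abs_mult sum_distrib_left[symmetric])
  also have "\<dots> \<le> D * K" using K[OF u' v'] D by simp
  finally show ?thesis by (simp add: D_def mult.commute)
qed

section \<open>The contraction coefficient\<close>

lemma kappa_bdd:
  assumes Q: "row_stochastic d Q"
  shows "bdd_above ((\<lambda>(u, v). tv_dist (push u Q) (push v Q)) ` (prob_simplex d \<times> prob_simplex d))"
  using push_simplex[OF Q] by (intro bdd_aboveI[where M = 1]) (auto intro!: tv_le_1)

lemma tv_le_kappa:
  assumes "row_stochastic d Q" "u \<in> prob_simplex d" "v \<in> prob_simplex d"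
  shows "tv_dist (push u Q) (push v Q) \<le> kappa Q"
  unfolding kappa_def row_stochasticD(2)[OF assms(1)]
  using cSUP_upper[OF _ kappa_bdd[OF assms(1)], of "(u, v)"] assms by simp

lemma kappa_le:
  assumes "row_stochastic d Q" "0 < d"
    and "\<And>u v. u \<in> prob_simplex d \<Longrightarrow> v \<in> prob_simplex d \<Longrightarrow> tv_dist (push u Q) (push v Q) \<le> K"
  shows "kappa Q \<le> K"
  unfolding kappa_def row_stochasticD(2)[OF assms(1)]
  using assms unit_vec_simplex[OF assms(2)] by (intro cSUP_least) auto

lemma kappa_le_1: "row_stochastic d Q \<Longrightarrow> 0 < d \<Longrightarrow> kappa Q \<le> 1"
  by (rule kappa_le) (auto intro!: tv_le_1 push_simplex)

lemma kappa_nonneg: "row_stochastic d Q \<Longrightarrow> 0 < d \<Longrightarrow> 0 \<le> kappa Q"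
  using tv_le_kappa[of d Q "unit_vec d 0" "unit_vec d 0"] unit_vec_simplex[of 0 d]
    tv_nonneg[of "push (unit_vec d 0) Q" "push (unit_vec d 0) Q"] by simp

lemma tv_push_le:
  assumes "row_stochastic d Q" "u \<in> prob_simplex d" "v \<in> prob_simplex d"
  shows "tv_dist (push u Q) (push v Q) \<le> kappa Q * tv_dist u v"
  using assms by (intro tv_push_scaled) (auto intro: tv_le_kappa)

lemma kappa_pow_add:
  assumes P: "row_stochastic d P" and d: "0 < d"
  shows "kappa (P ^\<^sub>m (a + b)) \<le> kappa (P ^\<^sub>m a) * kappa (P ^\<^sub>m b)"
proof (rule kappa_le[OF row_stochastic_pow[OF P] d])
  fix u v assume uv: "u \<in> prob_simplex d" "v \<in> prob_simplex d"
  let ?u = "push u (P ^\<^sub>m a)" and ?v = "push v (P ^\<^sub>m a)"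
  have c: "P \<in> carrier_mat d d" using P by (rule row_stochasticD)
  have "tv_dist (push ?u (P ^\<^sub>m b)) (push ?v (P ^\<^sub>m b)) \<le> kappa (P ^\<^sub>m b) * tv_dist ?u ?v"
    using uv by (intro tv_push_le[of d] push_simplex row_stochastic_pow P)
  also have "\<dots> \<le> kappa (P ^\<^sub>m b) * kappa (P ^\<^sub>m a)"
    using uv by (intro mult_left_mono tv_le_kappa[of d] row_stochastic_pow P
        kappa_nonneg[OF row_stochastic_pow[OF P] d]) auto
  finally show "tv_dist (push u (P ^\<^sub>m (a + b))) (push v (P ^\<^sub>m (a + b)))
      \<le> kappa (P ^\<^sub>m a) * kappa (P ^\<^sub>m b)"
    using uv by (simp add: push_pow_add[OF _ c] prob_simplexD mult.commute)
qed

lemma kappa_pow_antimono: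
  assumes "row_stochastic d P" "0 < d" "a \<le> b"
  shows "kappa (P ^\<^sub>m b) \<le> kappa (P ^\<^sub>m a)"
proof -
  have "kappa (P ^\<^sub>m b) \<le> kappa (P ^\<^sub>m a) * kappa (P ^\<^sub>m (b - a))"
    using kappa_pow_add[OF assms(1,2), of a "b - a"] assms(3) by simp
  also have "\<dots> \<le> kappa (P ^\<^sub>m a) * 1"
    by (intro mult_left_mono kappa_le_1[of d] kappa_nonneg[of d] row_stochastic_pow assms)
  finally show ?thesis by simp
qed

lemma kappa_pow_mult:
  assumes "row_stochastic d P" "0 < d"
  shows "kappa (P ^\<^sub>m (a * j)) \<le> kappa (P ^\<^sub>m a) ^ j"
proof (induction j)
  case 0
  \<comment> \<open>Only an inequality: the identity kernel has \<open>kappa\<close> 0 when there is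
    one state and 1 otherwise.\<close>
  then show ?case using kappa_le_1[OF row_stochastic_pow[OF assms(1)] assms(2), of 0] by simp
next
  case (Suc j)
  have "kappa (P ^\<^sub>m (a * Suc j)) \<le> kappa (P ^\<^sub>m a) * kappa (P ^\<^sub>m (a * j))"
    using kappa_pow_add[OF assms, of a "a * j"] by simp
  also have "\<dots> \<le> kappa (P ^\<^sub>m a) * kappa (P ^\<^sub>m a) ^ j"
    using Suc by (intro mult_left_mono kappa_nonneg[of d] row_stochastic_pow assms) auto
  finally show ?case by simp
qed

text \<open>Both sides are mixtures of rows with the same weights \<open>u\<close>, and total
  variation is convex.\<close>

lemma tv_push_perturb:
  assumes A: "row_stochastic d A" and B: "row_stochastic d B" and u: "u \<in> prob_simplex d"
    and e: "\<And>x. x < d \<Longrightarrow> tv_dist (row A x) (row B x) \<le> e"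
  shows "tv_dist (push u A) (push u B) \<le> e"
proof -
  note a = row_stochasticD[OF A] and b = row_stochasticD[OF B] and s = prob_simplexD[OF u]
  have "2 * tv_dist (push u A) (push u B) = (\<Sum>j<d. \<bar>\<Sum>i<d. u $ i * (A $$ (i, j) - B $$ (i, j))\<bar>)"
    using a b s by (simp add: tv_simplex[OF push_simplex[OF A u]] push_index sum_subtractf right_diff_distrib)
  also have "\<dots> \<le> (\<Sum>j<d. \<Sum>i<d. u $ i * \<bar>A $$ (i, j) - B $$ (i, j)\<bar>)"
    using s by (intro sum_mono order.trans[OF sum_abs]) (auto simp: abs_mult intro!: sum_mono)
  also have "\<dots> = (\<Sum>i<d. u $ i * (2 * tv_dist (row A i) (row B i)))"
    using a b by (subst sum.swap) (simp add: sum_distrib_left[symmetric] tv_simplex[OF a(6)])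
  also have "\<dots> \<le> (\<Sum>i<d. u $ i * (2 * e))"
    using s e by (intro sum_mono mult_left_mono) auto
  also have "\<dots> = 2 * e" using s by (simp add: sum_distrib_right[symmetric])
  finally show ?thesis by simp
qed

text \<open>Both pushed distributions move by at most \<open>e\<close>, hence the factor 2.\<close>

lemma kappa_perturb:
  assumes A: "row_stochastic d A" and B: "row_stochastic d B" and d: "0 < d"
    and e: "\<And>x. x < d \<Longrightarrow> tv_dist (row A x) (row B x) \<le> e"
  shows "\<bar>kappa A - kappa B\<bar> \<le> 2 * e"
proof -
  have *: "kappa A \<le> kappa B + 2 * e"
    if A: "row_stochastic d A" and B: "row_stochastic d B"
      and e: "\<And>x. x < d \<Longrightarrow> tv_dist (row A x) (row B x) \<le> e" for A B
  proof (rule kappa_le[OF A d])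
    fix u v assume uv: "u \<in> prob_simplex d" "v \<in> prob_simplex d"
    note s = prob_simplexD(2)[OF push_simplex[OF A uv(1)]] prob_simplexD(2)[OF push_simplex[OF A uv(2)]]
      prob_simplexD(2)[OF push_simplex[OF B uv(1)]] prob_simplexD(2)[OF push_simplex[OF B uv(2)]]
    have "tv_dist (push u A) (push v A) \<le> tv_dist (push u A) (push u B)
        + (tv_dist (push u B) (push v B) + tv_dist (push v B) (push v A))"
      using s by (intro order.trans[OF tv_triangle[of _ "push u B"]] add_left_mono tv_triangle) auto
    also have "tv_dist (push v B) (push v A) = tv_dist (push v A) (push v B)"
      using s by (intro tv_sym) auto
    finally show "tv_dist (push u A) (push v A) \<le> kappa B + 2 * e"
      using tv_push_perturb[OF A B uv(1) e] tv_push_perturb[OF A B uv(2) e] tv_le_kappa[OF B uv] by simp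
  qed
  have "tv_dist (row B x) (row A x) \<le> e" if "x < d" for x
    using e[OF that] tv_sym[of "row A x" "row B x"] A B by (simp add: row_stochasticD)
  then show ?thesis using *[OF A B e] *[OF B A] by fastforce
qed

section \<open>Ergodic kernels\<close>

lemma ergodicD:
  assumes "ergodic d P"
  shows "0 < d" "row_stochastic d P" "P \<in> carrier_mat d d" "dim_row P = d" "dim_col P = d"
  using assms row_stochasticD[of d P] by (auto simp: ergodic_def)

text \<open>Doeblin's argument: a pushed distribution has all entries at least the smallest entry
  \<open>a\<close> of a positive power, so two of them share mass \<open>d * a\<close>. Positivity
  of that power is returned as well, for \<open>stationary_pos\<close>.\<close>

lemma ergodic_kappa_less_1:
  assumes E: "ergodic d P"
  shows "\<exists>k\<ge>1. kappa (P ^\<^sub>m k) < 1 \<and> (\<forall>x<d. \<forall>y<d. 0 < (P ^\<^sub>m k) $$ (x, y))"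
proof -
  note e = ergodicD[OF E]
  obtain k where k: "1 \<le> k" and pos: "\<And>x y. x < d \<Longrightarrow> y < d \<Longrightarrow> 0 < (P ^\<^sub>m k) $$ (x, y)"
    using E by (auto simp: ergodic_def primitive_mat_def)
  let ?Q = "P ^\<^sub>m k"
  have Q: "row_stochastic d ?Q" using e by (simp add: row_stochastic_pow)
  define a where "a = Min ((\<lambda>(x, y). ?Q $$ (x, y)) ` ({..<d} \<times> {..<d}))"
  have a_le: "a \<le> ?Q $$ (x, y)" if "x < d" "y < d" for x y
    unfolding a_def using that by (intro Min_le) auto
  have a_pos: "0 < a"
    unfolding a_def using e(1) pos by (subst Min_gr_iff) auto
  have low: "a \<le> push u ?Q $ j" if u: "u \<in> prob_simplex d" and j: "j < d" for u j
  proof -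
    have "a = (\<Sum>i<d. u $ i * a)" using prob_simplexD[OF u] by (simp add: sum_distrib_right[symmetric])
    also have "\<dots> \<le> (\<Sum>i<d. u $ i * ?Q $$ (i, j))"
      using prob_simplexD[OF u] a_le j by (intro sum_mono mult_left_mono) auto
    also have "\<dots> = push u ?Q $ j"
      using push_index[OF prob_simplexD(1)[OF u] row_stochasticD(1)[OF Q] j] by simp
    finally show ?thesis .
  qed
  have "kappa ?Q \<le> 1 - real d * a"
  proof (rule kappa_le[OF Q e(1)])
    fix u v assume u: "u \<in> prob_simplex d" and v: "v \<in> prob_simplex d"
    have "tv_dist (push u ?Q) (push v ?Q) = (\<Sum>i<d. max 0 (push u ?Q $ i - push v ?Q $ i))"
      by (intro tv_pos_part push_simplex Q u v)
    also have "\<dots> \<le> (\<Sum>i<d. push u ?Q $ i - a)"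
      using low[OF u] low[OF v] by (intro sum_mono) auto
    also have "\<dots> = 1 - real d * a"
      using prob_simplexD(4)[OF push_simplex[OF Q u]] by (simp add: sum_subtractf)
    finally show "tv_dist (push u ?Q) (push v ?Q) \<le> 1 - real d * a" .
  qed
  also have "\<dots> < 1" using e(1) a_pos by simp
  finally show ?thesis using k pos by blast
qed

lemma ergodic_kappa_tendsto:
  assumes E: "ergodic d P"
  shows "(\<lambda>n. kappa (P ^\<^sub>m n)) \<longlonglongrightarrow> 0"
proof -
  note e = ergodicD[OF E]
  obtain k where k: "1 \<le> k" "kappa (P ^\<^sub>m k) < 1" using ergodic_kappa_less_1[OF E] by blast
  let ?c = "kappa (P ^\<^sub>m k)"
  have c0: "0 \<le> ?c" by (intro kappa_nonneg[of d] row_stochastic_pow e)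
  show ?thesis
  proof (rule LIMSEQ_I)
    fix r :: real assume "0 < r"
    then obtain j where j: "?c ^ j < r"
      using k(2) c0 real_arch_pow_inv[of r ?c] by auto
    have "norm (kappa (P ^\<^sub>m n) - 0) < r" if "k * j \<le> n" for n
    proof -
      have "kappa (P ^\<^sub>m n) \<le> kappa (P ^\<^sub>m (k * j))"
        by (rule kappa_pow_antimono[OF e(2,1) that])
      also have "\<dots> \<le> ?c ^ j" by (rule kappa_pow_mult[OF e(2,1)])
      finally show ?thesis using j kappa_nonneg[OF row_stochastic_pow[OF e(2)] e(1), of n] by simp
    qed
    then show "\<exists>no. \<forall>n\<ge>no. norm (kappa (P ^\<^sub>m n) - 0) < r" by blast
  qed
qed

lemma push_pow_fixed:
  assumes "v \<in> carrier_vec d" "P \<in> carrier_mat d d" "push v P = v"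
  shows "push v (P ^\<^sub>m n) = v"
proof (induction n)
  case (Suc n)
  then show ?case using assms push_mult[OF assms(1), of "P ^\<^sub>m n" P] by simp
qed (use assms in \<open>simp add: push_one\<close>)

text \<open>\<open>stationary\<close> is a \<open>THE\<close> that must be identified for powers of
  \<open>P\<close> too, hence the exponent \<open>s\<close>. A vector fixed by that power is fixed
  by \<open>P ^\<^sub>m (s * n)\<close> for every \<open>n\<close>, and the contraction coefficients
  of these tend to 0.\<close>

lemma ergodic_fixed_unique:
  assumes E: "ergodic d P" and s: "1 \<le> s"
    and v: "v \<in> prob_simplex d" "push v (P ^\<^sub>m s) = v"
    and w: "w \<in> prob_simplex d" "push w (P ^\<^sub>m s) = w"
  shows "v = w"
proof -
  note e = ergodicD[OF E]
  have "\<bar>v $ x - w $ x\<bar> \<le> 2 * kappa (P ^\<^sub>m n)" if x: "x < d" for x n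
  proof -
    have fv: "push v (P ^\<^sub>m (s * n)) = v" and fw: "push w (P ^\<^sub>m (s * n)) = w"
      unfolding pow_mat_mult[OF e(3)] using e v w by (auto intro: push_pow_fixed[of _ d] dest: prob_simplexD)
    have "\<bar>v $ x - w $ x\<bar> \<le> 2 * tv_dist v w" by (rule abs_diff_le_tv[OF v(1) x])
    also have "tv_dist v w \<le> kappa (P ^\<^sub>m (s * n))"
      using tv_le_kappa[OF row_stochastic_pow[OF e(2)] v(1) w(1), of "s * n"] fv fw by simp
    also have "\<dots> \<le> kappa (P ^\<^sub>m n)" using s by (intro kappa_pow_antimono[OF e(2,1)]) auto
    finally show ?thesis by simp
  qed
  moreover have "(\<lambda>n. 2 * kappa (P ^\<^sub>m n)) \<longlonglongrightarrow> 0"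
    using tendsto_mult[OF tendsto_const ergodic_kappa_tendsto[OF E], of 2] by simp
  ultimately have "\<bar>v $ x - w $ x\<bar> \<le> 0" if "x < d" for x
    using that by (intro LIMSEQ_le_const[where X = "\<lambda>n. 2 * kappa (P ^\<^sub>m n)"]) auto
  then show ?thesis using prob_simplexD(2)[OF v(1)] prob_simplexD(2)[OF w(1)] by (intro eq_vecI) auto
qed

text \<open>The orbit of a point mass is Cauchy, since its members \<open>n + k\<close> and
  \<open>n\<close> are images of two distributions under the same \<open>P ^\<^sub>m n\<close>. The
  limit is taken coordinatewise.\<close>

lemma ergodic_fixed_exists:
  assumes E: "ergodic d P"
  shows "\<exists>v \<in> prob_simplex d. push v P = v"
proof -
  note e = ergodicD[OF E]
  define u where "u n = push (unit_vec d 0) (P ^\<^sub>m n)" for n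
  have u: "u n \<in> prob_simplex d" for n
    unfolding u_def by (intro push_simplex row_stochastic_pow e unit_vec_simplex)
  have u_add: "u (k + n) = push (u k) (P ^\<^sub>m n)" for k n
    unfolding u_def using push_pow_add[OF unit_vec_carrier e(3)] by simp
  have diff: "\<bar>u (n + k) $ x - u n $ x\<bar> \<le> 2 * kappa (P ^\<^sub>m n)" if x: "x < d" for n k x
  proof -
    have "\<bar>u (n + k) $ x - u n $ x\<bar> \<le> 2 * tv_dist (u (n + k)) (u n)"
      by (rule abs_diff_le_tv[OF u x])
    also have "tv_dist (u (n + k)) (u n) \<le> kappa (P ^\<^sub>m n)"
      using tv_le_kappa[OF row_stochastic_pow[OF e(2)] u u, of k n 0] u_add[of k n] u_add[of 0 n]
      by (simp add: add.commute)
    finally show ?thesis by simp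
  qed
  have "convergent (\<lambda>n. u n $ x)" if x: "x < d" for x
  proof (rule real_Cauchy_convergent, rule CauchyI')
    fix r :: real assume "0 < r"
    then obtain M where M: "\<And>n. n \<ge> M \<Longrightarrow> kappa (P ^\<^sub>m n) < r / 2"
      using LIMSEQ_D[OF ergodic_kappa_tendsto[OF E], of "r / 2"]
        kappa_nonneg[OF row_stochastic_pow[OF e(2)] e(1)] by auto
    have "dist (u m $ x) (u n $ x) < r" if "M \<le> m" "m < n" for m n
      using diff[OF x, of m "n - m"] M[OF that(1)] that by (simp add: dist_real_def abs_minus_commute)
    then show "\<exists>M. \<forall>m\<ge>M. \<forall>n>m. dist (u m $ x) (u n $ x) < r" by blast
  qed
  then obtain l where l: "\<And>x. x < d \<Longrightarrow> (\<lambda>n. u n $ x) \<longlonglongrightarrow> l x"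
    unfolding convergent_def by metis
  define v where "v = vec d l"
  have v: "v \<in> prob_simplex d"
  proof -
    have "(\<lambda>n. \<Sum>x<d. u n $ x) \<longlonglongrightarrow> (\<Sum>x<d. l x)" by (intro tendsto_sum l) simp
    then have "(\<Sum>x<d. l x) = 1" using prob_simplexD(4)[OF u] by (simp add: LIMSEQ_const_iff)
    moreover have "0 \<le> l x" if "x < d" for x
      using prob_simplexD(3)[OF u that] by (intro LIMSEQ_le_const[OF l[OF that]]) auto
    ultimately show ?thesis by (simp add: prob_simplex_def v_def)
  qed
  have "push v P = v"
  proof (rule eq_vecI)
    show "dim_vec (push v P) = dim_vec v" using push_carrier[OF e(3), of v] by (simp add: v_def)
    fix j assume "j < dim_vec v"
    then have j: "j < d" by (simp add: v_def)
    have "(\<lambda>n. u (Suc n) $ j) = (\<lambda>n. \<Sum>i<d. u n $ i * P $$ (i, j))"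
      using u_add[of _ 1] push_index[OF prob_simplexD(1)[OF u] e(3) j] e by simp
    moreover have "(\<lambda>n. \<Sum>i<d. u n $ i * P $$ (i, j)) \<longlonglongrightarrow> (\<Sum>i<d. l i * P $$ (i, j))"
      by (intro tendsto_sum tendsto_mult l tendsto_const) simp
    moreover have "(\<lambda>n. u (Suc n) $ j) \<longlonglongrightarrow> l j" using l[OF j] by (rule LIMSEQ_Suc)
    ultimately have "l j = (\<Sum>i<d. l i * P $$ (i, j))" using LIMSEQ_unique by metis
    then show "push v P $ j = v $ j"
      using push_index[OF prob_simplexD(1)[OF v] e(3) j] j by (simp add: v_def)
  qed
  with v show ?thesis by blast
qed

lemma stationary_pow:
  assumes E: "ergodic d P" and s: "1 \<le> s"
  shows "stationary (P ^\<^sub>m s) = stationary P"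
    and "stationary P \<in> prob_simplex d"
    and "push (stationary P) (P ^\<^sub>m s) = stationary P"
proof -
  note e = ergodicD[OF E]
  obtain v where v: "v \<in> prob_simplex d" "push v P = v" using ergodic_fixed_exists[OF E] by blast
  have fix_pow: "push v (P ^\<^sub>m t) = v" for t
    using v e by (intro push_pow_fixed[of _ d]) (auto dest: prob_simplexD)
  have st: "stationary (P ^\<^sub>m t) = v" if "1 \<le> t" for t
    unfolding stationary_def
    by (rule the_equality) (use e v fix_pow ergodic_fixed_unique[OF E that] in auto)
  have "stationary P = v" using st[of 1] e(3) by simp
  then show "stationary (P ^\<^sub>m s) = stationary P" "stationary P \<in> prob_simplex d"
    "push (stationary P) (P ^\<^sub>m s) = stationary P"
    using st[OF s] v fix_pow by auto
qed

lemma stationary_pos: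
  assumes E: "ergodic d P" and x: "x < d"
  shows "0 < stationary P $ x"
proof -
  obtain k where k: "1 \<le> k" and pos: "\<And>x y. x < d \<Longrightarrow> y < d \<Longrightarrow> 0 < (P ^\<^sub>m k) $$ (x, y)"
    using ergodic_kappa_less_1[OF E] by blast
  let ?v = "stationary P"
  note e = ergodicD[OF E] and st = stationary_pow[OF E k]
  note s = prob_simplexD[OF st(2)]
  have "\<exists>i<d. ?v $ i \<noteq> 0" using s(4) by (metis lessThan_iff sum.neutral zero_neq_one)
  then obtain i where i: "i < d" "0 < ?v $ i" using s(3) by force
  have "?v $ x = (\<Sum>i<d. ?v $ i * (P ^\<^sub>m k) $$ (i, x))"
    using push_index[OF s(1) pow_carrier_mat[OF e(3)] x, of k] st(3) by simp
  also have "\<dots> > 0" using i x pos s(3) by (intro sum_pos2[of _ i]) (auto intro!: mult_nonneg_nonneg less_imp_le[OF pos])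
  finally show ?thesis .
qed

lemma pi_min_le:
  assumes "ergodic d P" "x < d"
  shows "pi_min P \<le> stationary P $ x"
  unfolding pi_min_def using ergodicD[OF assms(1)] assms(2) by (intro Min_le) auto

lemma pi_min_pos:
  assumes "ergodic d P"
  shows "0 < pi_min P"
  unfolding pi_min_def ergodicD(4)[OF assms] using ergodicD(1)[OF assms] stationary_pos[OF assms]
  by (subst Min_gr_iff) auto

text \<open>This trades the number of states in a union bound for \<open>1 / pi_min P\<close>, the
  quantity in the length condition.\<close>

lemma dim_pi_min_le:
  assumes "ergodic d P"
  shows "real d * pi_min P \<le> 1"
proof -
  have "real d * pi_min P = (\<Sum>x<d. pi_min P)" by simp
  also have "\<dots> \<le> (\<Sum>x<d. stationary P $ x)" using pi_min_le[OF assms] by (intro sum_mono) auto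
  also have "\<dots> = 1" using prob_simplexD(4)[OF stationary_pow(2)[OF assms le_refl]] .
  finally show ?thesis .
qed

text \<open>Passing through the stationary law turns two distances below 1/4 into a contraction
  coefficient of at most 1/2, a form that is submultiplicative and monotone in time.\<close>

lemma t_mix_props:
  assumes E: "ergodic d P"
  shows "1 \<le> t_mix P" and "\<And>t. t_mix P \<le> t \<Longrightarrow> kappa (P ^\<^sub>m t) \<le> 1/2"
proof -
  note e = ergodicD[OF E]
  let ?p = "stationary P"
  let ?D = "\<lambda>t. SUP v\<in>prob_simplex (dim_row P). tv_dist (push v (P ^\<^sub>m t)) ?p"
  let ?ok = "\<lambda>t. 1 \<le> t \<and> ?D t < 1/4"
  note p = stationary_pow(2)[OF E le_refl]
  note rs = row_stochastic_pow[OF e(2)]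
  have "\<exists>t. ?ok t"
  proof -
    \<comment> \<open>1/8 leaves room below 1/4, since a supremum inherits only the non-strict
      inequality.\<close>
    obtain M where M: "\<And>n. n \<ge> M \<Longrightarrow> kappa (P ^\<^sub>m n) < 1 / 8"
      using LIMSEQ_D[OF ergodic_kappa_tendsto[OF E], of "1 / 8"] kappa_nonneg[OF rs e(1)] by auto
    let ?t = "Suc M"
    have "?D ?t \<le> 1/8"
    proof (rule cSUP_least)
      show "prob_simplex (dim_row P) \<noteq> {}" using p e by auto
      fix v assume v: "v \<in> prob_simplex (dim_row P)"
      have "tv_dist (push v (P ^\<^sub>m ?t)) ?p = tv_dist (push v (P ^\<^sub>m ?t)) (push ?p (P ^\<^sub>m ?t))"
        using stationary_pow(3)[OF E, of ?t] by simp
      also have "\<dots> \<le> kappa (P ^\<^sub>m ?t)" using v e p by (intro tv_le_kappa[OF rs]) auto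
      finally show "tv_dist (push v (P ^\<^sub>m ?t)) ?p \<le> 1/8" using M[of ?t] by simp
    qed
    then show ?thesis by (intro exI[of _ ?t]) simp
  qed
  then have ok: "?ok (t_mix P)" unfolding t_mix_def by (rule LeastI_ex)
  then show "1 \<le> t_mix P" by simp
  have "kappa (P ^\<^sub>m t_mix P) \<le> 1/2"
  proof (rule kappa_le[OF rs e(1)])
    let ?Q = "P ^\<^sub>m t_mix P"
    have D: "tv_dist (push w ?Q) ?p \<le> ?D (t_mix P)" if "w \<in> prob_simplex d" for w
      using that e p
      by (intro cSUP_upper bdd_aboveI[where M = 1]) (auto intro!: tv_le_1[OF push_simplex[OF rs] p])
    fix u v assume u: "u \<in> prob_simplex d" and v: "v \<in> prob_simplex d"
    note s = prob_simplexD(2)[OF push_simplex[OF rs u]] prob_simplexD(2)[OF push_simplex[OF rs v]]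
      prob_simplexD(2)[OF p]
    have "tv_dist (push u ?Q) (push v ?Q) \<le> tv_dist (push u ?Q) ?p + tv_dist ?p (push v ?Q)"
      using s by (intro tv_triangle) simp
    also have "tv_dist ?p (push v ?Q) = tv_dist (push v ?Q) ?p" using s by (intro tv_sym) simp
    finally show "tv_dist (push u ?Q) (push v ?Q) \<le> 1/2" using D[OF u] D[OF v] ok by simp
  qed
  then show "kappa (P ^\<^sub>m t) \<le> 1/2" if "t_mix P \<le> t" for t
    using kappa_pow_antimono[OF e(2,1) that] by simp
qed

section \<open>Trajectories\<close>

lemma pmf_vec_pmf:
  assumes v: "v \<in> prob_simplex d"
  shows "pmf (vec_pmf v) i = (if i < d then v $ i else 0)"
proof -
  note s = prob_simplexD[OF v]
  have "(\<integral>\<^sup>+ x. ennreal (if x < dim_vec v then v $ x else 0) \<partial>count_space UNIV)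
      = (\<Sum>x<d. ennreal (if x < dim_vec v then v $ x else 0))"
    using s by (intro nn_integral_count_space') (auto split: if_splits)
  also have "\<dots> = ennreal (\<Sum>x<d. v $ x)" using s by (subst sum_ennreal[symmetric]) auto
  finally show ?thesis
    unfolding vec_pmf_def using s by (subst pmf_embed_pmf) auto
qed

lemma nn_integral_vec_pmf:
  fixes g :: "nat \<Rightarrow> ennreal"
  assumes v: "v \<in> prob_simplex d"
  shows "(\<integral>\<^sup>+ x. g x \<partial>vec_pmf v) = (\<Sum>x<d. g x * ennreal (v $ x))"
proof -
  have "(\<integral>\<^sup>+ x. g x \<partial>vec_pmf v) = (\<Sum>x<d. g x * pmf (vec_pmf v) x)"
    using pmf_vec_pmf[OF v] by (intro nn_integral_measure_pmf_support) (auto simp: set_pmf_iff)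
  then show ?thesis using pmf_vec_pmf[OF v] by simp
qed

lemma set_vec_pmf: "v \<in> prob_simplex d \<Longrightarrow> set_pmf (vec_pmf v) \<subseteq> {..<d}"
  by (auto simp: set_pmf_iff pmf_vec_pmf split: if_splits)

lemma bind_vec_pmf:
  assumes Q: "row_stochastic d Q" and v: "v \<in> prob_simplex d"
  shows "bind_pmf (vec_pmf v) (\<lambda>x. vec_pmf (row Q x)) = vec_pmf (push v Q)"
proof (rule pmf_eqI)
  fix i
  note q = row_stochasticD[OF Q] and s = prob_simplexD[OF v]
  have "ennreal (pmf (bind_pmf (vec_pmf v) (\<lambda>x. vec_pmf (row Q x))) i)
      = (\<Sum>x<d. ennreal (pmf (vec_pmf (row Q x)) i) * ennreal (v $ x))"
    by (simp add: ennreal_pmf_bind nn_integral_vec_pmf[OF v])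
  also have "\<dots> = (\<Sum>x<d. ennreal (if i < d then v $ x * Q $$ (x, i) else 0))"
    using q s by (intro sum.cong) (auto simp: pmf_vec_pmf[OF q(6)] ennreal_mult' mult.commute)
  also have "\<dots> = ennreal (if i < d then \<Sum>x<d. v $ x * Q $$ (x, i) else 0)"
    using q s by (subst sum_ennreal) auto
  also have "\<dots> = ennreal (pmf (vec_pmf (push v Q)) i)"
    using push_index[OF s(1) q(1)] by (simp add: pmf_vec_pmf[OF push_simplex[OF Q v]])
  finally show "pmf (bind_pmf (vec_pmf v) (\<lambda>x. vec_pmf (row Q x))) i = pmf (vec_pmf (push v Q)) i"
    by simp
qed

lemma markov_path_support:
  assumes Q: "row_stochastic d Q" and v: "v \<in> prob_simplex d"
    and "Y \<in> set_pmf (markov_path v Q n)"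
  shows "length Y = n" "set Y \<subseteq> {..<d}"
proof -
  have "length Y = n \<and> set Y \<subseteq> {..<d}"
    using assms(2,3)
  proof (induction n arbitrary: v Y)
    case (Suc n)
    obtain x Z where Y: "Y = x # Z" and x: "x \<in> set_pmf (vec_pmf v)"
      and Z: "Z \<in> set_pmf (markov_path (row Q x) Q n)"
      using Suc.prems(2) by auto
    have "x < d" using set_vec_pmf[OF Suc.prems(1)] x by auto
    with Suc.IH[OF row_stochasticD(6)[OF Q] Z] show ?case by (simp add: Y)
  qed simp
  then show "length Y = n" "set Y \<subseteq> {..<d}" by auto
qed

section \<open>Multiplicative functionals of the trajectory\<close>

definition path_prod :: "(nat \<Rightarrow> nat \<Rightarrow> real) \<Rightarrow> nat list \<Rightarrow> real" where
  "path_prod h Y = (\<Prod>t<length Y - 1. h (Y ! t) (Y ! Suc t))"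

lemma path_prod_simps:
  "path_prod h [] = 1" "path_prod h [x] = 1"
  "path_prod h (x # y # ys) = h x y * path_prod h (y # ys)"
  by (simp_all add: path_prod_def prod.lessThan_Suc_shift del: prod.lessThan_Suc)

lemma path_prod_nonneg: "(\<And>x y. 0 \<le> h x y) \<Longrightarrow> 0 \<le> path_prod h Y"
  by (simp add: path_prod_def prod_nonneg)

text \<open>A supermartingale: by \<open>step\<close>, each further factor has conditional mean at
  most 1 whatever the current state is, so the initial law \<open>v\<close> is arbitrary.\<close>

lemma expectation_path_prod_le_1:
  assumes Q: "row_stochastic d Q" and v: "v \<in> prob_simplex d"
    and h: "\<And>x y. 0 \<le> h x y" and step: "\<And>x. x < d \<Longrightarrow> (\<Sum>y<d. Q $$ (x, y) * h x y) \<le> 1"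
  shows "(\<integral>\<^sup>+ Y. ennreal (path_prod h Y) \<partial>markov_path v Q n) \<le> 1"
proof -
  note q = row_stochasticD[OF Q]
  \<comment> \<open>The first state is kept outside the law: \<open>markov_path\<close> recurses at
    the head, and the first factor of the product needs the state before the tail.\<close>
  have *: "(\<integral>\<^sup>+ Y. ennreal (path_prod h (x # Y)) \<partial>markov_path (row Q x) Q n) \<le> 1" if "x < d" for x n
    using that
  proof (induction n arbitrary: x)
    case (Suc n)
    have "(\<integral>\<^sup>+ Y. ennreal (path_prod h (x # Y)) \<partial>markov_path (row Q x) Q (Suc n))
        = (\<Sum>y<d. (ennreal (h x y) * (\<integral>\<^sup>+ Y. ennreal (path_prod h (y # Y)) \<partial>markov_path (row Q y) Q n))
            * ennreal (Q $$ (x, y)))"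
      using Suc.prems q h
      by (simp add: nn_integral_vec_pmf[OF q(6)] path_prod_simps ennreal_mult path_prod_nonneg nn_integral_cmult)
    also have "\<dots> \<le> (\<Sum>y<d. (ennreal (h x y) * 1) * ennreal (Q $$ (x, y)))"
      using Suc.IH by (intro sum_mono mult_right_mono mult_left_mono) auto
    also have "\<dots> = ennreal (\<Sum>y<d. Q $$ (x, y) * h x y)"
      using h q Suc.prems
      by (subst sum_ennreal[symmetric]) (auto simp: ennreal_mult' mult.commute intro!: sum.cong)
    also have "\<dots> \<le> 1" using step[OF Suc.prems] by simp
    finally show ?case .
  qed (simp add: path_prod_simps)
  show ?thesis
  proof (cases n)
    case (Suc k)
    have "(\<integral>\<^sup>+ Y. ennreal (path_prod h Y) \<partial>markov_path v Q n)
        = (\<Sum>x<d. (\<integral>\<^sup>+ Y. ennreal (path_prod h (x # Y)) \<partial>markov_path (row Q x) Q k) * ennreal (v $ x))"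
      unfolding Suc by (simp add: nn_integral_vec_pmf[OF v])
    also have "\<dots> \<le> (\<Sum>x<d. 1 * ennreal (v $ x))"
      using * by (intro sum_mono mult_right_mono) auto
    also have "\<dots> = ennreal (\<Sum>x<d. v $ x)"
      using prob_simplexD(3)[OF v] by (subst sum_ennreal[symmetric]) auto
    also have "\<dots> = 1" using prob_simplexD(4)[OF v] by simp
    finally show ?thesis .
  qed (simp add: path_prod_simps)
qed

text \<open>Markov's inequality. The lower bound \<open>C\<close> is required only on lists of
  length \<open>n\<close> over the state space, which carry all the mass.\<close>

lemma prob_path_prod_le:
  assumes Q: "row_stochastic d Q" and v: "v \<in> prob_simplex d"
    and h: "\<And>x y. 0 \<le> h x y" and step: "\<And>x. x < d \<Longrightarrow> (\<Sum>y<d. Q $$ (x, y) * h x y) \<le> 1"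
    and C: "0 < C"
    and A: "\<And>Y. Y \<in> A \<Longrightarrow> length Y = n \<Longrightarrow> set Y \<subseteq> {..<d} \<Longrightarrow> C \<le> path_prod h Y"
  shows "measure_pmf.prob (markov_path v Q n) A \<le> 1 / C"
proof -
  let ?M = "markov_path v Q n"
  have "ennreal C * emeasure ?M A = (\<integral>\<^sup>+ Y. ennreal C * indicator A Y \<partial>?M)"
    by (simp add: nn_integral_cmult)
  also have "\<dots> \<le> (\<integral>\<^sup>+ Y. ennreal (path_prod h Y) \<partial>?M)"
  proof (rule nn_integral_mono_AE, rule AE_pmfI)
    fix Y assume "Y \<in> set_pmf ?M"
    then show "ennreal C * indicator A Y \<le> ennreal (path_prod h Y)"
      using A markov_path_support[OF Q v] by (auto simp: indicator_def intro!: ennreal_leI)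
  qed
  also have "\<dots> \<le> 1" by (rule expectation_path_prod_le_1[OF Q v h step])
  finally have "ennreal (C * measure_pmf.prob ?M A) \<le> ennreal 1"
    using C by (simp add: measure_pmf.emeasure_eq_measure ennreal_mult')
  then have "C * measure_pmf.prob ?M A \<le> 1" by (subst (asm) ennreal_le_iff) auto
  then show ?thesis using C by (simp add: field_simps)
qed

section \<open>Dropping and skipping observations\<close>

lemma map_tl_markov_path:
  assumes P: "row_stochastic d P" and v: "v \<in> prob_simplex d"
  shows "map_pmf tl (markov_path v P n) = markov_path (push v P) P (n - 1)"
proof (cases n)
  case (Suc k)
  have "map_pmf tl (markov_path v P (Suc k)) = bind_pmf (vec_pmf v) (\<lambda>x. markov_path (row P x) P k)"
    by (simp add: map_bind_pmf pmf.map_comp o_def)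
  also have "\<dots> = markov_path (push v P) P k"
    by (cases k) (simp_all add: bind_return_pmf bind_assoc_pmf bind_vec_pmf[OF P v, symmetric])
  finally show ?thesis using Suc by simp
qed simp

lemma map_drop_markov_path:
  assumes P: "row_stochastic d P" and v: "v \<in> prob_simplex d"
  shows "map_pmf (drop k) (markov_path v P n) = markov_path (push v (P ^\<^sub>m k)) P (n - k)"
proof (induction k)
  case 0
  then show ?case using P v by (simp add: push_one prob_simplexD row_stochasticD pmf.map_ident)
next
  case (Suc k)
  have "map_pmf (drop (Suc k)) (markov_path v P n) = map_pmf tl (map_pmf (drop k) (markov_path v P n))"
    unfolding pmf.map_comp by (intro arg_cong[where f = "\<lambda>f. map_pmf f _"] ext) (simp add: drop_Suc tl_drop)
  also have "\<dots> = markov_path (push (push v (P ^\<^sub>m k)) P) P (n - k - 1)"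
    unfolding Suc by (rule map_tl_markov_path[OF P push_simplex[OF row_stochastic_pow[OF P] v]])
  finally show ?case
    using push_mult[OF prob_simplexD(1)[OF v], of "P ^\<^sub>m k" P] row_stochasticD(1)[OF P] by simp
qed

text \<open>A recursion matching that of \<open>markov_path\<close>: the next kept observation is
  \<open>s\<close> steps after the head, at index \<open>s - 1\<close> of the tail, unless that lies
  beyond the end.\<close>

lemma skipped_Cons:
  assumes "1 \<le> s"
  shows "skipped s (x # Y) = x # (if s \<le> length Y then skipped s (drop (s - 1) Y) else [])"
proof (cases "s \<le> length Y")
  case True
  then have e: "length Y div s = Suc ((length Y - s) div s)"
    using assms by (metis le_div_geq less_eq_Suc_le One_nat_def)
  show ?thesis
  proof (rule nth_equalityI)
    show "length (skipped s (x # Y)) =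
        length (x # (if s \<le> length Y then skipped s (drop (s - 1) Y) else []))"
      using True e assms by (simp add: skipped_def)
    fix i assume "i < length (skipped s (x # Y))"
    then have i: "i < Suc (length Y div s)" by (simp add: skipped_def)
    show "skipped s (x # Y) ! i = (x # (if s \<le> length Y then skipped s (drop (s - 1) Y) else [])) ! i"
    proof (cases i)
      case 0
      then show ?thesis by (simp add: skipped_def del: upt_Suc)
    next
      case (Suc j)
      have "s + j * s = Suc (s - 1 + j * s)" using assms by simp
      then show ?thesis
        using True e assms i Suc by (simp add: skipped_def nth_append nth_Cons' del: upt_Suc)
    qed
  qed
next
  case False
  then show ?thesis by (simp add: skipped_def)
qed

text \<open>The estimator skips by \<open>s\<close> and then by \<open>r\<close>; this reduces it to
  plain rates. Iterated integer division agrees with division by the product, and the kept indices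
  stay in range.\<close>

lemma skipped_skipped:
  assumes "1 \<le> s"
  shows "skipped r (skipped s X) = skipped (r * s) X"
proof -
  have "j * r \<le> (length X - 1) div s" if "j \<le> (length X - 1) div s div r" for j
    using that by (metis div_le_dividend le_trans mult_le_mono1 div_times_less_eq_dividend)
  then show ?thesis
    by (auto simp: skipped_def div_mult2_eq mult.commute[of r s] mult.assoc mult.left_commute nth_append
        less_Suc_eq_le simp del: upt_Suc)
qed

text \<open>The form \<open>Suc n\<close> keeps the list nonempty, as \<open>skipped\<close>
  demands, and makes \<open>n\<close> the number of transitions, which skipping divides by
  \<open>s\<close>.\<close>

lemma map_skipped_markov_path:
  assumes P: "row_stochastic d P" and v: "v \<in> prob_simplex d" and s: "1 \<le> s"
  shows "map_pmf (skipped s) (markov_path v P (Suc n)) = markov_path v (P ^\<^sub>m s) (Suc (n div s))"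
  using v
proof (induction n arbitrary: v rule: less_induct)
  case (less n)
  note p = row_stochasticD[OF P]
  let ?R = "\<lambda>x. markov_path (row P x) P n"
  have "map_pmf (skipped s) (map_pmf (Cons x) (?R x))
      = map_pmf (Cons x) (markov_path (row (P ^\<^sub>m s) x) (P ^\<^sub>m s) (n div s))" if x: "x < d" for x
  proof (cases "s \<le> n")
    case True
    have "map_pmf (skipped s) (map_pmf (Cons x) (?R x))
        = map_pmf (\<lambda>Y. x # skipped s (drop (s - 1) Y)) (?R x)"
      unfolding pmf.map_comp o_def
      by (rule map_pmf_cong) (use s True markov_path_support[OF P p(6)[OF x]] in \<open>auto simp: skipped_Cons\<close>)
    also have "\<dots> = map_pmf (Cons x) (map_pmf (skipped s) (map_pmf (drop (s - 1)) (?R x)))"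
      by (simp add: pmf.map_comp o_def)
    also have "map_pmf (drop (s - 1)) (?R x) = markov_path (push (row P x) (P ^\<^sub>m (s - 1))) P (Suc (n - s))"
      using map_drop_markov_path[OF P p(6)[OF x], of "s - 1" n] s True by (simp add: Suc_diff_le)
    \<comment> \<open>One step leads from \<open>x\<close> to the head of the tail; dropping
      \<open>s - 1\<close> states supplies the other powers.\<close>
    also have "push (row P x) (P ^\<^sub>m (s - 1)) = row (P ^\<^sub>m s) x"
    proof -
      have "P ^\<^sub>m s = P * P ^\<^sub>m (s - 1)"
        using pow_mat_add[OF p(1), of 1 "s - 1"] s p by simp
      then show ?thesis using row_mult_eq_push[OF p(1) pow_carrier_mat[OF p(1)] x] by simp
    qed
    also have "map_pmf (skipped s) (markov_path (row (P ^\<^sub>m s) x) P (Suc (n - s)))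
        = markov_path (row (P ^\<^sub>m s) x) (P ^\<^sub>m s) (Suc ((n - s) div s))"
      using s True by (intro less row_stochasticD(6)[OF row_stochastic_pow[OF P] x]) auto
    also have "Suc ((n - s) div s) = n div s"
      using True s by (simp add: le_div_geq)
    finally show ?thesis .
  next
    case False
    have "map_pmf (skipped s) (map_pmf (Cons x) (?R x)) = map_pmf (\<lambda>Y. [x]) (?R x)"
      unfolding pmf.map_comp o_def
      by (rule map_pmf_cong) (use s False markov_path_support[OF P p(6)[OF x]] in \<open>auto simp: skipped_Cons\<close>)
    then show ?thesis using False by (simp add: map_pmf_const)
  qed
  then show ?case
    using set_vec_pmf[OF less.prems] by (auto simp: map_bind_pmf intro!: bind_pmf_cong)
qed

section \<open>Concentration of visits and transitions\<close>

text \<open>As sums over the transition times, counts have exponentials that are instances of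
  \<open>path_prod\<close>.\<close>

lemma visits_eq_sum: "real (visits Y x) = (\<Sum>t<length Y - 1. of_bool (Y ! t = x))"
proof -
  have "{t. t + 1 < length Y \<and> Y ! t = x} = {t\<in>{..<length Y - 1}. Y ! t = x}" by auto
  then show ?thesis by (simp add: visits_def sum.If_cases of_bool_def Int_def)
qed

lemma transitions_eq_sum:
  "real (transitions Y x z) = (\<Sum>t<length Y - 1. of_bool (Y ! t = x \<and> Y ! Suc t = z))"
proof -
  have "{t. t + 1 < length Y \<and> Y ! t = x \<and> Y ! (t + 1) = z}
      = {t\<in>{..<length Y - 1}. Y ! t = x \<and> Y ! Suc t = z}" by auto
  then show ?thesis by (simp add: transitions_def sum.If_cases of_bool_def Int_def)
qed

lemma sum_transitions:
  assumes "finite A"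
  shows "(\<Sum>z\<in>A. real (transitions Y x z)) = (\<Sum>t<length Y - 1. of_bool (Y ! t = x \<and> Y ! Suc t \<in> A))"
proof -
  have "(\<Sum>z\<in>A. of_bool (a \<and> b = z)) = (of_bool (a \<and> b \<in> A) :: real)" for a b
    using assms by (cases a) (auto simp: of_bool_def sum.delta)
  then show ?thesis unfolding transitions_eq_sum by (subst sum.swap) simp
qed

text \<open>Every block of \<open>\<tau>\<close> steps halves the distance to \<open>p\<close>; the
  factor 2 passes from total variation to a single entry.\<close>

lemma pow_entry_near_stationary:
  assumes Q: "row_stochastic d Q" and p: "p \<in> prob_simplex d" "push p Q = p"
    and d: "0 < d" and half: "kappa (Q ^\<^sub>m \<tau>) \<le> 1/2" and x: "x < d" and y: "y < d"
  shows "\<bar>(Q ^\<^sub>m t) $$ (y, x) - p $ x\<bar> \<le> 2 * (1/2) ^ (t div \<tau>)"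
proof -
  note q = row_stochasticD[OF Q] and rs = row_stochastic_pow[OF Q]
  have c: "Q ^\<^sub>m t \<in> carrier_mat d d" using q by simp
  have fixed: "push p (Q ^\<^sub>m t) = p" using push_pow_fixed[OF prob_simplexD(1)[OF p(1)] q(1) p(2)] .
  have "\<bar>(Q ^\<^sub>m t) $$ (y, x) - p $ x\<bar> = \<bar>row (Q ^\<^sub>m t) y $ x - p $ x\<bar>"
    by (simp add: q(2,3) x y)
  also have "\<dots> \<le> 2 * tv_dist (row (Q ^\<^sub>m t) y) p"
    by (rule abs_diff_le_tv[OF row_stochasticD(6)[OF rs y] x])
  also have "tv_dist (row (Q ^\<^sub>m t) y) p \<le> kappa (Q ^\<^sub>m t)"
    using tv_le_kappa[OF rs unit_vec_simplex[OF y] p(1), of t] push_unit_vec[OF c y] fixed by simp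
  also have "\<dots> \<le> kappa (Q ^\<^sub>m (\<tau> * (t div \<tau>)))"
    by (intro kappa_pow_antimono[OF Q d]) simp
  also have "\<dots> \<le> kappa (Q ^\<^sub>m \<tau>) ^ (t div \<tau>)" by (rule kappa_pow_mult[OF Q d])
  also have "\<dots> \<le> (1/2) ^ (t div \<tau>)" by (intro power_mono half kappa_nonneg[OF rs d])
  finally show ?thesis by simp
qed

lemma sum_geometric_blocks:
  assumes "1 \<le> \<tau>"
  shows "(\<Sum>t<k * \<tau>. (1/2::real) ^ (t div \<tau>)) \<le> 2 * real \<tau>"
proof -
  have "(\<Sum>t<k * \<tau>. (1/2::real) ^ (t div \<tau>)) = (\<Sum>j<k. \<Sum>t\<in>{j * \<tau>..<j * \<tau> + \<tau>}. (1/2) ^ (t div \<tau>))"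
    by (rule sum.nat_group[symmetric])
  also have "\<dots> = (\<Sum>j<k. \<Sum>t\<in>{j * \<tau>..<j * \<tau> + \<tau>}. (1/2) ^ j)"
  proof (intro sum.cong refl)
    fix j t assume "t \<in> {j * \<tau>..<j * \<tau> + \<tau>}"
    then have "t div \<tau> = j" by (intro div_nat_eqI) (auto simp: mult.commute)
    then show "(1/2::real) ^ (t div \<tau>) = (1/2) ^ j" by simp
  qed
  also have "\<dots> = real \<tau> * (\<Sum>j<k. (1/2) ^ j)" by (simp add: sum_distrib_left)
  also have "\<dots> \<le> real \<tau> * 2" by (intro mult_left_mono) (simp_all add: sum_gp_strict)
  finally show ?thesis by simp
qed

text \<open>An approximate solution \<open>w\<close> of the Poisson equation \<open>w - Q w = 1\<^sub>x - p x\<close> makes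
  \<open>1 - c w\<close> a Lyapunov function that controls the exponential moments of \<open>- visits\<close> without any
  reversibility assumption.\<close>

lemma approximate_poisson_solution:
  assumes Q: "row_stochastic d Q" and p: "p \<in> prob_simplex d" "push p Q = p"
    and d: "0 < d" and half: "kappa (Q ^\<^sub>m \<tau>) \<le> 1/2" and tau: "1 \<le> \<tau>"
    and x: "x < d" and px: "0 < p $ x"
  shows "\<exists>w r. \<forall>y<d. \<bar>w y\<bar> \<le> 4 * real \<tau> \<and> p $ x / 2 \<le> r y \<and>
    (\<Sum>z<d. Q $$ (y, z) * w z) = w y - of_bool (y = x) + r y"
proof -
  note q = row_stochasticD[OF Q] and rs = row_stochastic_pow[OF Q]
  \<comment> \<open>After \<open>k\<close> blocks the truncation remainder differs from
    \<open>p $ x\<close> by less than \<open>p $ x / 2\<close>.\<close>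
  obtain k where k: "(1/2::real) ^ k < p $ x / 4"
    using real_arch_pow_inv[of "p $ x / 4" "1/2"] px by auto
  define w where "w y = (\<Sum>t<k * \<tau>. (Q ^\<^sub>m t) $$ (y, x) - p $ x)" for y
  have near: "\<bar>(Q ^\<^sub>m t) $$ (y, x) - p $ x\<bar> \<le> 2 * (1/2) ^ (t div \<tau>)" if "y < d" for y t
    by (rule pow_entry_near_stationary[OF Q p d half x that])
  have "\<bar>w y\<bar> \<le> 4 * real \<tau>" if y: "y < d" for y
  proof -
    have "\<bar>w y\<bar> \<le> (\<Sum>t<k * \<tau>. 2 * (1/2) ^ (t div \<tau>))"
      unfolding w_def by (intro order.trans[OF sum_abs] sum_mono near y)
    also have "\<dots> \<le> 4 * real \<tau>"
      using sum_geometric_blocks[OF tau, of k] by (simp add: sum_distrib_left[symmetric])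
    finally show ?thesis .
  qed
  moreover have "p $ x / 2 \<le> (Q ^\<^sub>m (k * \<tau>)) $$ (y, x)" if "y < d" for y
    using near[OF that, of "k * \<tau>"] k tau by simp
  moreover have "(\<Sum>z<d. Q $$ (y, z) * w z) = w y - of_bool (y = x) + (Q ^\<^sub>m (k * \<tau>)) $$ (y, x)"
    if y: "y < d" for y
  proof -
    have step: "(\<Sum>z<d. Q $$ (y, z) * (Q ^\<^sub>m t) $$ (z, x)) = (Q ^\<^sub>m Suc t) $$ (y, x)" for t
    proof -
      have "Q ^\<^sub>m Suc t = Q * Q ^\<^sub>m t" using pow_mat_add[OF q(1), of 1 t] q by simp
      then show ?thesis using x y q by (simp add: scalar_prod_def atLeast0LessThan del: pow_mat.simps)
    qed
    have "(\<Sum>z<d. Q $$ (y, z) * w z)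
        = (\<Sum>t<k * \<tau>. (\<Sum>z<d. Q $$ (y, z) * (Q ^\<^sub>m t) $$ (z, x)) - p $ x * (\<Sum>z<d. Q $$ (y, z)))"
      unfolding w_def sum_distrib_left
      by (subst sum.swap) (simp add: right_diff_distrib sum_subtractf sum_distrib_left mult.commute)
    also have "\<dots> = (\<Sum>t<k * \<tau>. (Q ^\<^sub>m Suc t) $$ (y, x) - p $ x)"
      unfolding step using q(5)[OF y] by simp
    \<comment> \<open>Applying \<open>Q\<close> shifts the series by one, so only its ends survive:
      the identity yields \<open>of_bool (y = x)\<close>, the last power yields the remainder
      \<open>r\<close>.\<close>
    also have "\<dots> = w y + (\<Sum>t<k * \<tau>. (Q ^\<^sub>m Suc t) $$ (y, x) - (Q ^\<^sub>m t) $$ (y, x))"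
      unfolding w_def by (simp add: sum.distrib[symmetric] del: pow_mat.simps)
    also have "\<dots> = w y + (Q ^\<^sub>m (k * \<tau>)) $$ (y, x) - of_bool (y = x)"
      using x y q by (subst sum_lessThan_telescope) (auto simp: one_mat_def)
    finally show ?thesis by simp
  qed
  ultimately show ?thesis
    by (intro exI[of _ w] exI[of _ "\<lambda>y. (Q ^\<^sub>m (k * \<tau>)) $$ (y, x)"]) simp
qed

text \<open>The factor \<open>h\<close> rewards every step by \<open>\<rho>\<close> and charges
  \<open>3 * c\<close> for a visit to \<open>x\<close>; the ratio \<open>f z / f y\<close> balances
  this in the mean and telescopes along the trajectory. Few visits leave the product exponentially
  large, which is unlikely.\<close>

lemma prob_few_visits:
  assumes Q: "row_stochastic d Q" and p: "p \<in> prob_simplex d" "push p Q = p"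
    and d: "0 < d" and half: "kappa (Q ^\<^sub>m \<tau>) \<le> 1/2" and tau: "1 \<le> \<tau>"
    and x: "x < d" and px: "0 < p $ x" and v: "v \<in> prob_simplex d"
  shows "measure_pmf.prob (markov_path v Q (Suc M)) {Y. real (visits Y x) \<le> p $ x * M / 18}
    \<le> 3 * exp (- (p $ x * M / (48 * real \<tau>)))"
proof -
  note q = row_stochasticD[OF Q]
  obtain w r where w: "\<And>y. y < d \<Longrightarrow> \<bar>w y\<bar> \<le> 4 * real \<tau>" and r: "\<And>y. y < d \<Longrightarrow> p $ x / 2 \<le> r y"
    and poisson: "\<And>y. y < d \<Longrightarrow> (\<Sum>z<d. Q $$ (y, z) * w z) = w y - of_bool (y = x) + r y"
    using approximate_poisson_solution[OF Q p d half tau x px] by blast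
  \<comment> \<open>With this \<open>c\<close> the bound on \<open>w\<close> gives
    \<open>\<bar>c * w y\<bar> \<le> 1/2\<close>, so \<open>f\<close> lies between 1/2 and 3/2. The
    ratio of its end values is at least 1/3, whence the factor 3 in the claim.\<close>
  define c where "c = 1 / (8 * real \<tau>)"
  have c: "0 < c" using tau by (simp add: c_def)
  define f where "f y = (if y < d then 1 - c * w y else 1)" for y
  have f: "1/2 \<le> f y" "f y \<le> 3/2" for y
  proof -
    have "\<bar>c * w y\<bar> \<le> 1/2" if "y < d"
    proof -
      have "\<bar>c * w y\<bar> \<le> c * (4 * real \<tau>)" using w[OF that] c by (simp add: abs_mult)
      also have "\<dots> = 1/2" using tau by (simp add: c_def)
      finally show ?thesis .
    qed
    then show "1/2 \<le> f y" "f y \<le> 3/2" by (auto simp: f_def abs_le_iff)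
  qed
  have p1: "p $ x \<le> 1"
    using prob_simplexD[OF p(1)] x member_le_sum[of x "{..<d}" "\<lambda>i. p $ i"] by simp
  \<comment> \<open>Away from \<open>x\<close> the mean of \<open>f\<close> drops by at least
    \<open>c * p $ x / 2\<close>, which covers \<open>\<rho> * f y\<close> as
    \<open>f y \<le> 3/2\<close>. At \<open>x\<close> it rises by at most
    \<open>c \<le> 2 * c * f y\<close>; the charge \<open>3 * c\<close> pays for this and for
    \<open>\<rho> \<le> c\<close>.\<close>
  define \<rho> where "\<rho> = c * p $ x / 3"
  have rho: "\<rho> \<le> c" "0 \<le> \<rho>" using p1 px c by (auto simp: \<rho>_def mult_left_le)
  define h where "h y z = exp (\<rho> - 3 * c * of_bool (y = x)) * (f z / f y)" for y z
  have f_pos: "0 < f y" for y using f(1)[of y] by linarith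
  have Qf: "(\<Sum>z<d. Q $$ (y, z) * f z) = f y + c * of_bool (y = x) - c * r y" if y: "y < d" for y
  proof -
    have eq: "(\<Sum>z<d. Q $$ (y, z) * f z) = (\<Sum>z<d. Q $$ (y, z)) - c * (\<Sum>z<d. Q $$ (y, z) * w z)"
      by (simp add: f_def right_diff_distrib sum_subtractf sum_distrib_left mult.left_commute)
    show ?thesis unfolding eq poisson[OF y] q(5)[OF y] using y by (simp add: f_def algebra_simps)
  qed
  have step: "(\<Sum>z<d. Q $$ (y, z) * h y z) \<le> 1" if y: "y < d" for y
  proof -
    have eq: "(\<Sum>z<d. Q $$ (y, z) * h y z)
        = exp (\<rho> - 3 * c * of_bool (y = x)) * (f y + c * of_bool (y = x) - c * r y) / f y"
      unfolding Qf[OF y, symmetric] by (simp add: h_def sum_distrib_left sum_divide_distrib mult_ac)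
    have cr: "c * (p $ x / 2) \<le> c * r y" using r[OF y] c by simp
    have "exp (\<rho> - 3 * c * of_bool (y = x)) * (f y + c * of_bool (y = x) - c * r y) \<le> f y"
    proof (cases "y = x")
      case True
      have "f y + c - c * r y \<le> f y + c" using cr c px by (smt (verit) mult_pos_pos half_gt_zero)
      also have "\<dots> \<le> f y * (1 + 2 * c)" using f(1)[of y] c mult_right_mono[of "1/2" "f y" c] by (simp add: algebra_simps)
      also have "\<dots> \<le> f y * exp (2 * c)" using f_pos[of y] by (intro mult_left_mono exp_ge_add_one_self) auto
      finally have "exp (\<rho> - 3 * c) * (f y + c - c * r y) \<le> exp (\<rho> - 3 * c) * (f y * exp (2 * c))"
        by simp
      also have "\<dots> = f y * exp (\<rho> - c)" by (simp add: exp_add[symmetric] exp_diff)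
          (simp add: field_simps exp_add[symmetric])
      also have "\<dots> \<le> f y" using rho f_pos[of y] by simp
      finally show ?thesis using True by simp
    next
      case False
      have "f y - c * r y \<le> f y - c * (p $ x / 2)" using cr by simp
      also have "\<dots> \<le> f y * (1 - \<rho>)"
        using f(2)[of y] rho mult_right_mono[of "f y" "3/2" \<rho>] by (simp add: \<rho>_def algebra_simps)
      also have "\<dots> \<le> f y * exp (- \<rho>)"
        using f_pos[of y] exp_ge_add_one_self[of "- \<rho>"] by (intro mult_left_mono) auto
      finally have "exp \<rho> * (f y - c * r y) \<le> exp \<rho> * (f y * exp (- \<rho>))" by simp
      then show ?thesis using False by (simp add: exp_minus field_simps)
    qed
    then show ?thesis unfolding eq using f_pos[of y] by (simp add: divide_le_eq)
  qed
  let ?C = "exp (p $ x * M / (48 * real \<tau>)) / 3"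
  have "measure_pmf.prob (markov_path v Q (Suc M)) {Y. real (visits Y x) \<le> p $ x * M / 18} \<le> 1 / ?C"
  proof (rule prob_path_prod_le[OF Q v _ step])
    show "0 \<le> h y z" for y z using f_pos by (simp add: h_def less_imp_le)
    fix Y assume "Y \<in> {Y. real (visits Y x) \<le> p $ x * M / 18}" and len: "length Y = Suc M"
    then have V: "real (visits Y x) \<le> p $ x * M / 18" by simp
    have "(\<Prod>t<M. f (Y ! Suc t) / f (Y ! t)) = f (Y ! M) / f (Y ! 0)"
      using f_pos by (intro prod_lessThan_telescope) (auto simp: less_imp_neq[symmetric])
    moreover have "(\<Prod>t<M. exp (\<rho> - 3 * c * of_bool (Y ! t = x))) = exp (\<rho> * M - 3 * c * visits Y x)"
      unfolding visits_eq_sum len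
      by (simp add: exp_sum[symmetric] sum_subtractf sum_distrib_left[symmetric] mult.commute)
    ultimately have W: "path_prod h Y = exp (\<rho> * M - 3 * c * visits Y x) * (f (Y ! M) / f (Y ! 0))"
      unfolding path_prod_def len h_def by (simp add: prod.distrib del: times_divide_eq_right)
    \<comment> \<open>The threshold \<open>p $ x * M / 18\<close> makes the charge at most half of
      \<open>\<rho> * M\<close>; the other half is
      \<open>p $ x * M / (48 * real \<tau>)\<close>.\<close>
    have "3 * c * visits Y x \<le> 3 * c * (p $ x * M / 18)" using V c by (intro mult_left_mono) auto
    also have "\<dots> = \<rho> * M - p $ x * M / (48 * real \<tau>)" using tau by (simp add: \<rho>_def c_def field_simps)
    finally have "exp (p $ x * M / (48 * real \<tau>)) \<le> exp (\<rho> * M - 3 * c * visits Y x)" by simp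
    moreover have "1/3 \<le> f (Y ! M) / f (Y ! 0)"
      using f(1)[of "Y ! M"] f(2)[of "Y ! 0"] f_pos[of "Y ! 0"] by (simp add: field_simps)
    ultimately have "exp (p $ x * M / (48 * real \<tau>)) * (1/3) \<le> path_prod h Y"
      unfolding W by (intro mult_mono) auto
    then show "?C \<le> path_prod h Y" by simp
  qed auto
  then show ?thesis by (simp add: exp_minus field_simps)
qed

text \<open>For negative \<open>u\<close>, \<open>exp u \<le> 1 / (1 - u)\<close>, and
  \<open>(1 + u + u\<^sup>2) * (1 - u) = 1 - u ^ 3\<close> is at least 1.\<close>

lemma exp_le_quadratic:
  fixes u :: real
  assumes "\<bar>u\<bar> \<le> 1"
  shows "exp u \<le> 1 + u + u\<^sup>2"
proof (cases "0 \<le> u")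
  case True
  then show ?thesis using assms by (intro exp_bound) auto
next
  case False
  have "exp u = 1 / exp (- u)" by (simp add: exp_minus field_simps)
  also have "\<dots> \<le> 1 / (1 - u)"
    using False exp_ge_add_one_self[of "- u"] by (intro divide_left_mono) auto
  also have "\<dots> \<le> 1 + u + u\<^sup>2"
  proof -
    have "u\<^sup>2 * u \<le> 0" using False by (intro mult_nonneg_nonpos) auto
    then have "1 \<le> (1 + u + u\<^sup>2) * (1 - u)" by (simp add: algebra_simps power2_eq_square)
    then show ?thesis using False by (simp add: divide_le_eq)
  qed
  finally show ?thesis .
qed

text \<open>The compensator \<open>s\<^sup>2\<close> is charged per visit to \<open>x\<close>, and
  other states contribute the factor 1. So the number of visits may stay random and is bounded below
  by \<open>N\<close> only at the end, without conditioning. The lower tail is the relevant one,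
  since total variation can be read off from the deficits of the empirical row.\<close>

lemma prob_few_transitions:
  assumes Q: "row_stochastic d Q" and v: "v \<in> prob_simplex d"
    and x: "x < d" and A: "A \<subseteq> {..<d}" and eta: "0 < \<eta>" "\<eta> \<le> 1"
  shows "measure_pmf.prob (markov_path v Q n)
      {Y. N \<le> real (visits Y x) \<and>
          (\<Sum>z\<in>A. real (transitions Y x z)) \<le> ((\<Sum>z\<in>A. Q $$ (x, z)) - \<eta>) * visits Y x}
    \<le> exp (- (\<eta>\<^sup>2 * N / 4))"
proof -
  note q = row_stochasticD[OF Q]
  have finA: "finite A" using A finite_subset by blast
  \<comment> \<open>This maximises the gain \<open>s * \<eta> - s\<^sup>2\<close> per visit, with
    value \<open>\<eta>\<^sup>2 / 4\<close>.\<close>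
  define s where "s = \<eta> / 2"
  define a where "a = (\<Sum>z\<in>A. Q $$ (x, z))"
  have a: "0 \<le> a" "a \<le> 1"
    using q(4)[OF x] q(5)[OF x] sum_mono2[of "{..<d}" A "\<lambda>z. Q $$ (x, z)"] A
    by (auto simp: a_def intro!: sum_nonneg)
  define h where "h y z = (if y = x then exp (s * (a - of_bool (z \<in> A)) - s\<^sup>2) else 1)" for y z
  have a_eq: "(\<Sum>z<d. Q $$ (x, z) * of_bool (z \<in> A)) = a"
    unfolding a_def using A by (simp add: of_bool_def if_distrib sum.If_cases Int_absorb1 cong: if_cong)
  have step: "(\<Sum>z<d. Q $$ (y, z) * h y z) \<le> 1" if y: "y < d" for y
  proof (cases "y = x")
    case True
    have le: "exp (s * (a - of_bool (z \<in> A))) \<le> 1 + s * (a - of_bool (z \<in> A)) + s\<^sup>2" for z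
    proof -
      have b: "\<bar>a - of_bool (z \<in> A)\<bar> \<le> 1" using a by auto
      then have "\<bar>s * (a - of_bool (z \<in> A))\<bar> \<le> 1 * 1"
        unfolding abs_mult using eta by (intro mult_mono) (auto simp: s_def)
      then have "exp (s * (a - of_bool (z \<in> A))) \<le> 1 + s * (a - of_bool (z \<in> A)) + (s * (a - of_bool (z \<in> A)))\<^sup>2"
        by (intro exp_le_quadratic) simp
      also have "(s * (a - of_bool (z \<in> A)))\<^sup>2 \<le> s\<^sup>2 * 1"
        unfolding power_mult_distrib using b by (intro mult_left_mono) (auto simp: abs_square_le_1)
      finally show ?thesis by simp
    qed
    have "(\<Sum>z<d. Q $$ (x, z) * exp (s * (a - of_bool (z \<in> A))))
        \<le> (\<Sum>z<d. Q $$ (x, z) * (1 + s * (a - of_bool (z \<in> A)) + s\<^sup>2))"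
      using q(4)[OF x] le by (intro sum_mono mult_left_mono) auto
    also have "\<dots> = (1 + s * a + s\<^sup>2) * (\<Sum>z<d. Q $$ (x, z)) - s * (\<Sum>z<d. Q $$ (x, z) * of_bool (z \<in> A))"
      by (simp add: algebra_simps sum.distrib sum_subtractf sum_distrib_left
          del: sum_mult_of_bool_eq sum_of_bool_mult_eq)
    also have "\<dots> = 1 + s\<^sup>2" using q(5)[OF x] a_eq by simp
    also have "\<dots> \<le> exp (s\<^sup>2)" by simp
    finally have "exp (- s\<^sup>2) * (\<Sum>z<d. Q $$ (x, z) * exp (s * (a - of_bool (z \<in> A)))) \<le> exp (- s\<^sup>2) * exp (s\<^sup>2)"
      by simp
    also have "exp (- s\<^sup>2) * (\<Sum>z<d. Q $$ (x, z) * exp (s * (a - of_bool (z \<in> A)))) = (\<Sum>z<d. Q $$ (x, z) * h x z)"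
      by (simp add: h_def sum_distrib_left exp_diff exp_minus exp_add field_simps)
    finally show ?thesis using True by (simp add: exp_minus)
  next
    case False
    then show ?thesis using q(5)[OF y] by (simp add: h_def)
  qed
  have "measure_pmf.prob (markov_path v Q n) {Y. N \<le> real (visits Y x) \<and>
          (\<Sum>z\<in>A. real (transitions Y x z)) \<le> (a - \<eta>) * visits Y x} \<le> 1 / exp (\<eta>\<^sup>2 * N / 4)"
  proof (rule prob_path_prod_le[OF Q v _ step])
    show "0 \<le> h y z" for y z by (simp add: h_def)
    fix Y assume "Y \<in> {Y. N \<le> real (visits Y x) \<and> (\<Sum>z\<in>A. real (transitions Y x z)) \<le> (a - \<eta>) * visits Y x}"
    then have N: "N \<le> real (visits Y x)"
      and T: "(\<Sum>z\<in>A. real (transitions Y x z)) \<le> (a - \<eta>) * visits Y x" by auto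
    have "path_prod h Y
        = (\<Prod>t<length Y - 1. exp ((s * a - s\<^sup>2) * of_bool (Y ! t = x) - s * of_bool (Y ! t = x \<and> Y ! Suc t \<in> A)))"
      unfolding path_prod_def h_def by (intro prod.cong) (auto simp: algebra_simps)
    also have "\<dots> = exp ((s * a - s\<^sup>2) * visits Y x - s * (\<Sum>z\<in>A. real (transitions Y x z)))"
      unfolding visits_eq_sum sum_transitions[OF finA]
      by (simp add: exp_sum[symmetric] sum_subtractf sum_distrib_left)
    finally have W: "path_prod h Y = exp ((s * a - s\<^sup>2) * visits Y x - s * (\<Sum>z\<in>A. real (transitions Y x z)))" .
    have "\<eta>\<^sup>2 * N / 4 \<le> \<eta>\<^sup>2 * visits Y x / 4" using N by (intro divide_right_mono mult_left_mono) auto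
    also have "\<dots> = (s * a - s\<^sup>2) * visits Y x - s * ((a - \<eta>) * visits Y x)"
      by (simp add: s_def power2_eq_square field_simps)
    also have "\<dots> \<le> (s * a - s\<^sup>2) * visits Y x - s * (\<Sum>z\<in>A. real (transitions Y x z))"
      using T eta by (intro diff_left_mono mult_left_mono) (auto simp: s_def)
    finally show "exp (\<eta>\<^sup>2 * N / 4) \<le> path_prod h Y" unfolding W by simp
  qed auto
  then show ?thesis unfolding a_def by (simp add: exp_minus field_simps)
qed

section \<open>Empirical kernels\<close>

text \<open>\<open>visits\<close> omits the last position, so each counted visit has exactly one
  successor and the counts in a row add up. Smoothing keeps the denominator positive at unvisited
  states.\<close>

lemma row_stochastic_P_hat:
  assumes lam: "lam \<in> carrier_vec d" "\<And>x. x < d \<Longrightarrow> 0 < lam $ x" and Y: "set Y \<subseteq> {..<d}"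
  shows "row_stochastic d (P_hat lam Y)"
proof (rule row_stochasticI)
  show "P_hat lam Y \<in> carrier_mat d d" using lam by (auto simp: P_hat_def)
  have entry: "P_hat lam Y $$ (x, y)
      = (real (transitions Y x y) + lam $ x) / (real (visits Y x) + lam $ x * real d)"
    if "x < d" "y < d" for x y
    using that lam by (simp add: P_hat_def)
  show "0 \<le> P_hat lam Y $$ (x, y)" if "x < d" "y < d" for x y
    unfolding entry[OF that] using that lam(2)[OF that(1)] by simp
  fix x assume x: "x < d"
  have "(\<Sum>y<d. real (transitions Y x y)) = visits Y x"
    unfolding sum_transitions[OF finite_lessThan] visits_eq_sum
  proof (intro sum.cong refl)
    fix t assume "t \<in> {..<length Y - 1}"
    then have "Y ! Suc t \<in> set Y" by (intro nth_mem) auto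
    then show "of_bool (Y ! t = x \<and> Y ! Suc t \<in> {..<d}) = (of_bool (Y ! t = x) :: real)" using Y by auto
  qed
  moreover have "0 < real (visits Y x) + lam $ x * real d"
    using lam(2)[OF x] x by (intro add_nonneg_pos mult_pos_pos) auto
  ultimately show "(\<Sum>y<d. P_hat lam Y $$ (x, y)) = 1"
    by (simp add: entry x sum_divide_distrib[symmetric] sum.distrib mult.commute)
qed

text \<open>Only states where the empirical row is too small count. The three \<open>\<eta>\<close>
  come from the mass outside \<open>B\<close>, from the deviation in \<open>dev\<close>, and from
  the smoothing, which enlarges the denominator by at most
  \<open>\<eta> * visits Y x\<close>.\<close>

lemma tv_P_hat_row:
  assumes lam: "lam \<in> carrier_vec d" "\<And>x. x < d \<Longrightarrow> 0 < lam $ x" and Y: "set Y \<subseteq> {..<d}"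
    and Q: "row_stochastic d Q" and x: "x < d"
    and B: "B \<subseteq> {..<d}" "(\<Sum>z\<in>{..<d} - B. Q $$ (x, z)) \<le> \<eta>"
    and visits: "0 < visits Y x" "lam $ x * real d \<le> \<eta> * visits Y x"
    and dev: "\<And>A. A \<subseteq> B \<Longrightarrow>
      ((\<Sum>z\<in>A. Q $$ (x, z)) - \<eta>) * visits Y x \<le> (\<Sum>z\<in>A. real (transitions Y x z))"
  shows "tv_dist (row Q x) (row (P_hat lam Y) x) \<le> 3 * \<eta>"
proof -
  have rs: "row_stochastic d (P_hat lam Y)" by (rule row_stochastic_P_hat[OF lam Y])
  note q = row_stochasticD[OF Q] and r = row_stochasticD[OF rs]
  define V D where "V = real (visits Y x)" and "D = V + lam $ x * real d"
  have V: "0 < V" using visits by (simp add: V_def)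
  have lx: "0 < lam $ x * real d" using lam(2)[OF x] x by (intro mult_pos_pos) auto
  have "0 < \<eta> * V" unfolding V_def using lx visits(2) by linarith
  then have eta: "0 < \<eta>" using V by (simp add: zero_less_mult_iff)
  have D: "V \<le> D" "0 < D" using V lx by (auto simp: D_def)
  have entry: "real (transitions Y x z) / D \<le> P_hat lam Y $$ (x, z)" if "z < d" for z
  proof -
    have "P_hat lam Y $$ (x, z) = (real (transitions Y x z) + lam $ x) / D"
      using that x lam(1) by (simp add: P_hat_def D_def V_def)
    then show ?thesis using D(2) lam(2)[OF x] by (simp add: divide_right_mono)
  qed
  \<comment> \<open>This set depends on the trajectory, so \<open>dev\<close> has to cover every
    subset of \<open>B\<close>.\<close>
  define A where "A = {z\<in>B. P_hat lam Y $$ (x, z) < Q $$ (x, z)}"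
  define a where "a = (\<Sum>z\<in>A. Q $$ (x, z))"
  have AB: "A \<subseteq> B" "A \<subseteq> {..<d}" using B by (auto simp: A_def)
  have finB: "finite B" using B finite_subset by blast
  have a1: "a \<le> 1" unfolding a_def q(5)[OF x, symmetric]
    using AB q(4)[OF x] by (intro sum_mono2) auto
  have "a - (\<Sum>z\<in>A. P_hat lam Y $$ (x, z)) \<le> 2 * \<eta>"
  proof -
    have "(a - \<eta>) * V \<le> (\<Sum>z\<in>A. real (transitions Y x z))"
      using dev[OF AB(1)] by (simp add: a_def V_def)
    also have "\<dots> = D * (\<Sum>z\<in>A. real (transitions Y x z) / D)"
      using D by (simp add: sum_divide_distrib[symmetric])
    also have "\<dots> \<le> D * (\<Sum>z\<in>A. P_hat lam Y $$ (x, z))"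
      using D AB by (intro mult_left_mono sum_mono entry) auto
    finally have "D * (a - (\<Sum>z\<in>A. P_hat lam Y $$ (x, z))) \<le> a * (D - V) + \<eta> * V"
      by (simp add: algebra_simps)
    also have "a * (D - V) \<le> 1 * (D - V)" using a1 D by (intro mult_right_mono) auto
    also have "1 * (D - V) \<le> \<eta> * V" using visits(2) by (simp add: D_def V_def)
    also have "\<eta> * V + \<eta> * V \<le> D * (2 * \<eta>)" using D eta mult_left_mono[of V D \<eta>] by simp
    finally show ?thesis using D by simp
  qed
  have "tv_dist (row Q x) (row (P_hat lam Y) x)
      = (\<Sum>z<d. max 0 (Q $$ (x, z) - P_hat lam Y $$ (x, z)))"
    unfolding tv_pos_part[OF q(6)[OF x] r(6)[OF x]] using x q r by (intro sum.cong) auto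
  also have "\<dots> = (\<Sum>z\<in>B. max 0 (Q $$ (x, z) - P_hat lam Y $$ (x, z)))
      + (\<Sum>z\<in>{..<d} - B. max 0 (Q $$ (x, z) - P_hat lam Y $$ (x, z)))"
    using B(1) by (subst add.commute, intro sum.subset_diff) auto
  also have "\<dots> \<le> (\<Sum>z\<in>A. Q $$ (x, z) - P_hat lam Y $$ (x, z)) + \<eta>"
  proof (rule add_mono)
    have "(\<Sum>z\<in>B. max 0 (Q $$ (x, z) - P_hat lam Y $$ (x, z)))
        = (\<Sum>z\<in>A. max 0 (Q $$ (x, z) - P_hat lam Y $$ (x, z)))"
      using finB AB by (intro sum.mono_neutral_right) (auto simp: A_def)
    also have "\<dots> = (\<Sum>z\<in>A. Q $$ (x, z) - P_hat lam Y $$ (x, z))"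
      by (intro sum.cong) (auto simp: A_def)
    finally show "(\<Sum>z\<in>B. max 0 (Q $$ (x, z) - P_hat lam Y $$ (x, z)))
        \<le> (\<Sum>z\<in>A. Q $$ (x, z) - P_hat lam Y $$ (x, z))" by simp
    have "(\<Sum>z\<in>{..<d} - B. max 0 (Q $$ (x, z) - P_hat lam Y $$ (x, z))) \<le> (\<Sum>z\<in>{..<d} - B. Q $$ (x, z))"
      using q(4)[OF x] r(4)[OF x] by (intro sum_mono) auto
    then show "(\<Sum>z\<in>{..<d} - B. max 0 (Q $$ (x, z) - P_hat lam Y $$ (x, z))) \<le> \<eta>" using B(2) by simp
  qed
  also have "\<dots> = a - (\<Sum>z\<in>A. P_hat lam Y $$ (x, z)) + \<eta>" by (simp add: a_def sum_subtractf)
  finally show ?thesis using \<open>a - _ \<le> 2 * \<eta>\<close> by simp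
qed

text \<open>Up to mass \<open>\<eta>\<close>, a distribution lives on at most \<open>half_norm q / \<eta>\<close> states: those of mass at
  least \<open>\<eta>\<^sup>2 / half_norm q\<close>. This is how the quantity \<open>Gamma_mat\<close> enters.\<close>

lemma half_norm_heavy_set:
  assumes q: "q \<in> prob_simplex d" and eta: "0 < \<eta>"
  shows "\<exists>B\<subseteq>{..<d}. (\<Sum>z\<in>{..<d} - B. q $ z) \<le> \<eta> \<and> real (card B) \<le> half_norm q / \<eta>"
proof -
  note s = prob_simplexD[OF q]
  define S where "S = (\<Sum>z<d. sqrt (q $ z))"
  have hn: "half_norm q = S\<^sup>2" using s by (simp add: half_norm_def S_def)
  have S: "0 < S"
  proof -
    have "S \<noteq> 0"
    proof
      assume "S = 0"
      then have "\<forall>z\<in>{..<d}. sqrt (q $ z) = 0"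
        unfolding S_def using s by (subst (asm) sum_nonneg_eq_0_iff) auto
      then show False using s(4) by simp
    qed
    moreover have "0 \<le> S" unfolding S_def using s by (intro sum_nonneg) auto
    ultimately show ?thesis by simp
  qed
  \<comment> \<open>Off this set \<open>q $ z\<close> is at most
    \<open>\<eta> / S * sqrt (q $ z)\<close>, which sums to at most \<open>\<eta>\<close>. On it
    each root takes at least \<open>\<eta> / S\<close> of the total \<open>S\<close>, so there are
    at most \<open>S\<^sup>2 / \<eta>\<close> states.\<close>
  define B where "B = {z\<in>{..<d}. \<eta> / S \<le> sqrt (q $ z)}"
  have "(\<Sum>z\<in>{..<d} - B. q $ z) \<le> (\<Sum>z\<in>{..<d} - B. \<eta> / S * sqrt (q $ z))"
  proof (rule sum_mono)
    fix z assume z: "z \<in> {..<d} - B"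
    then have "sqrt (q $ z) * sqrt (q $ z) \<le> \<eta> / S * sqrt (q $ z)"
      using s(3) by (intro mult_right_mono) (auto simp: B_def)
    then show "q $ z \<le> \<eta> / S * sqrt (q $ z)" using z s(3) by simp
  qed
  also have "\<dots> \<le> (\<Sum>z<d. \<eta> / S * sqrt (q $ z))" using s(3) S eta by (intro sum_mono2) auto
  also have "\<dots> = \<eta>" 
    unfolding sum_distrib_left[symmetric] S_def[symmetric] using S by simp
  finally have light: "(\<Sum>z\<in>{..<d} - B. q $ z) \<le> \<eta>" .
  have "real (card B) * (\<eta> / S) = (\<Sum>z\<in>B. \<eta> / S)" by simp
  also have "\<dots> \<le> (\<Sum>z\<in>B. sqrt (q $ z))" by (intro sum_mono) (simp add: B_def)
  also have "\<dots> \<le> S" unfolding S_def using s(3) by (intro sum_mono2) (auto simp: B_def)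
  finally have "real (card B) \<le> half_norm q / \<eta>"
    unfolding hn using S eta by (simp add: field_simps power2_eq_square)
  with light show ?thesis by (intro exI[of _ B]) (auto simp: B_def)
qed

text \<open>Three demands on the length: \<open>smooth\<close> lets the visits outweigh the
  smoothing, \<open>learn\<close> pays for all subsets of the heavy states, \<open>mix\<close> makes
  the visit count reliable. The factor 4 is 3 for too few visits plus 1 for a deviating
  subset.\<close>

lemma prob_bad_row:
  assumes Q: "row_stochastic d Q" and p: "p \<in> prob_simplex d" "push p Q = p"
    and d: "0 < d" and half: "kappa (Q ^\<^sub>m \<tau>) \<le> 1/2" and tau: "1 \<le> \<tau>"
    and x: "x < d" and px: "0 < p $ x" and v: "v \<in> prob_simplex d"
    and lam: "lam \<in> carrier_vec d" "\<And>x. x < d \<Longrightarrow> 0 < lam $ x" "lam $ x * real d \<le> L"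
    and eta: "0 < \<eta>" "\<eta> \<le> 1"
    and smooth: "L / \<eta> \<le> p $ x * M / 18"
    and learn: "half_norm (row Q x) / \<eta> + \<Lambda> \<le> \<eta>\<^sup>2 * (p $ x * M / 18) / 4"
    and mix: "\<Lambda> \<le> p $ x * M / (48 * real \<tau>)"
  shows "measure_pmf.prob (markov_path v Q (Suc M))
      {Y. set Y \<subseteq> {..<d} \<and> 3 * \<eta> < tv_dist (row Q x) (row (P_hat lam Y) x)} \<le> 4 * exp (- \<Lambda>)"
proof -
  let ?M = "markov_path v Q (Suc M)"
  note q = row_stochasticD[OF Q]
  define N where "N = p $ x * M / 18"
  obtain B where B: "B \<subseteq> {..<d}" "(\<Sum>z\<in>{..<d} - B. row Q x $ z) \<le> \<eta>"
      "real (card B) \<le> half_norm (row Q x) / \<eta>"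
    using half_norm_heavy_set[OF q(6)[OF x] eta(1)] by blast
  have finB: "finite B" using B(1) finite_subset by blast
  have light: "(\<Sum>z\<in>{..<d} - B. Q $$ (x, z)) \<le> \<eta>" using B(2) q(2,3) x by simp
  let ?E = "{Y. real (visits Y x) \<le> N}"
  let ?F = "\<lambda>A. {Y. N \<le> real (visits Y x) \<and>
          (\<Sum>z\<in>A. real (transitions Y x z)) \<le> ((\<Sum>z\<in>A. Q $$ (x, z)) - \<eta>) * visits Y x}"
  have "0 < lam $ x * real d" using lam(2)[OF x] d by (intro mult_pos_pos) auto
  then have "0 < L / \<eta>" using lam(3) eta by (intro divide_pos_pos) linarith+
  then have N0: "0 < N" unfolding N_def using smooth by linarith
  have sub: "{Y. set Y \<subseteq> {..<d} \<and> 3 * \<eta> < tv_dist (row Q x) (row (P_hat lam Y) x)}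
      \<subseteq> ?E \<union> (\<Union>A\<in>Pow B. ?F A)"
  proof (rule subsetI, rule ccontr)
    fix Y assume Y: "Y \<in> {Y. set Y \<subseteq> {..<d} \<and> 3 * \<eta> < tv_dist (row Q x) (row (P_hat lam Y) x)}"
      and no: "Y \<notin> ?E \<union> (\<Union>A\<in>Pow B. ?F A)"
    have V: "N < real (visits Y x)" using no by auto
    have "L \<le> \<eta> * N" using smooth eta by (simp add: N_def field_simps)
    also have "\<dots> \<le> \<eta> * visits Y x" using V eta by (intro mult_left_mono) auto
    finally have "lam $ x * real d \<le> \<eta> * visits Y x" using lam(3) by simp
    moreover have "0 < visits Y x" using V N0 by (metis gr0I less_asym of_nat_0)
    moreover have "((\<Sum>z\<in>A. Q $$ (x, z)) - \<eta>) * visits Y x \<le> (\<Sum>z\<in>A. real (transitions Y x z))"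
      if "A \<subseteq> B" for A
      using no that V by (auto simp: not_le less_imp_le)
    ultimately have "tv_dist (row Q x) (row (P_hat lam Y) x) \<le> 3 * \<eta>"
      using Y by (intro tv_P_hat_row[OF lam(1,2) _ Q x B(1) light]) auto
    then show False using Y by simp
  qed
  have "measure_pmf.prob ?M {Y. set Y \<subseteq> {..<d} \<and> 3 * \<eta> < tv_dist (row Q x) (row (P_hat lam Y) x)}
      \<le> measure_pmf.prob ?M (?E \<union> (\<Union>A\<in>Pow B. ?F A))"
    using sub by (intro measure_pmf.finite_measure_mono) auto
  also have "\<dots> \<le> measure_pmf.prob ?M ?E + measure_pmf.prob ?M (\<Union>A\<in>Pow B. ?F A)"
    by (intro measure_Un_le) auto
  also have "\<dots> \<le> 3 * exp (- \<Lambda>) + exp (- \<Lambda>)"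
  proof (rule add_mono)
    have "measure_pmf.prob ?M ?E \<le> 3 * exp (- (p $ x * M / (48 * real \<tau>)))"
      unfolding N_def by (rule prob_few_visits[OF Q p d half tau x px v])
    also have "\<dots> \<le> 3 * exp (- \<Lambda>)" using mix by simp
    finally show "measure_pmf.prob ?M ?E \<le> 3 * exp (- \<Lambda>)" .
    have "measure_pmf.prob ?M (\<Union>A\<in>Pow B. ?F A) \<le> (\<Sum>A\<in>Pow B. measure_pmf.prob ?M (?F A))"
      using finB by (intro measure_pmf.finite_measure_subadditive_finite) auto
    also have "\<dots> \<le> (\<Sum>A\<in>Pow B. exp (- (\<eta>\<^sup>2 * N / 4)))"
      using B(1) by (intro sum_mono prob_few_transitions[OF Q v x _ eta]) auto
    also have "\<dots> = 2 ^ card B * exp (- (\<eta>\<^sup>2 * N / 4))" using finB by (simp add: card_Pow)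
    \<comment> \<open>The union over subsets thus costs \<open>card B\<close> in the exponent,
      covered by the term \<open>half_norm (row Q x) / \<eta>\<close> of
      \<open>learn\<close>.\<close>
    also have "\<dots> \<le> exp (real (card B)) * exp (- (\<eta>\<^sup>2 * N / 4))"
    proof (intro mult_right_mono)
      have "(2::real) ^ card B \<le> exp 1 ^ card B" using exp_ge_add_one_self[of 1] by (intro power_mono) auto
      then show "2 ^ card B \<le> exp (real (card B))" by (simp add: exp_of_nat_mult[symmetric])
    qed simp
    also have "\<dots> \<le> exp (- \<Lambda>)"
    proof -
      have "real (card B) - \<eta>\<^sup>2 * N / 4 \<le> - \<Lambda>" unfolding N_def using B(3) learn by linarith
      then show ?thesis by (simp add: exp_add[symmetric])
    qed
    finally show "measure_pmf.prob ?M (\<Union>A\<in>Pow B. ?F A) \<le> exp (- \<Lambda>)" .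
  qed
  finally show ?thesis by simp
qed

text \<open>\<open>kappa_perturb\<close> doubles the row error \<open>3 * \<eta>\<close>, and the
  union over rows costs the factor \<open>d\<close>.\<close>

lemma prob_kappa_P_hat:
  assumes Q: "row_stochastic d Q" and p: "p \<in> prob_simplex d" "push p Q = p"
    and d: "0 < d" and half: "kappa (Q ^\<^sub>m \<tau>) \<le> 1/2" and tau: "1 \<le> \<tau>"
    and px: "\<And>x. x < d \<Longrightarrow> 0 < p $ x" and v: "v \<in> prob_simplex d"
    and lam: "lam \<in> carrier_vec d" "\<And>x. x < d \<Longrightarrow> 0 < lam $ x" "\<And>x. x < d \<Longrightarrow> lam $ x * real d \<le> L"
    and eta: "0 < \<eta>" "\<eta> \<le> 1"
    and smooth: "\<And>x. x < d \<Longrightarrow> L / \<eta> \<le> p $ x * M / 18"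
    and learn: "\<And>x. x < d \<Longrightarrow> half_norm (row Q x) / \<eta> + \<Lambda> \<le> \<eta>\<^sup>2 * (p $ x * M / 18) / 4"
    and mix: "\<And>x. x < d \<Longrightarrow> \<Lambda> \<le> p $ x * M / (48 * real \<tau>)"
  shows "measure_pmf.prob (markov_path v Q (Suc M)) {Y. 6 * \<eta> < \<bar>kappa (P_hat lam Y) - kappa Q\<bar>}
    \<le> 4 * real d * exp (- \<Lambda>)"
proof -
  let ?M = "markov_path v Q (Suc M)"
  let ?E = "\<lambda>x. {Y. set Y \<subseteq> {..<d} \<and> 3 * \<eta> < tv_dist (row Q x) (row (P_hat lam Y) x)}"
  have "measure_pmf.prob ?M {Y. 6 * \<eta> < \<bar>kappa (P_hat lam Y) - kappa Q\<bar>} \<le> measure_pmf.prob ?M (\<Union>x<d. ?E x)"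
  proof (rule measure_pmf.finite_measure_mono_AE)
    show "AE Y in ?M. Y \<in> {Y. 6 * \<eta> < \<bar>kappa (P_hat lam Y) - kappa Q\<bar>} \<longrightarrow> Y \<in> (\<Union>x<d. ?E x)"
    proof (rule AE_pmfI, rule impI, rule ccontr)
      fix Y assume "Y \<in> set_pmf ?M" and Y: "Y \<in> {Y. 6 * \<eta> < \<bar>kappa (P_hat lam Y) - kappa Q\<bar>}"
        and no: "Y \<notin> (\<Union>x<d. ?E x)"
      then have st: "set Y \<subseteq> {..<d}" using markov_path_support(2)[OF Q v] by blast
      then have "tv_dist (row Q x) (row (P_hat lam Y) x) \<le> 3 * \<eta>" if "x < d" for x
        using no that by (auto simp: not_less)
      then have "\<bar>kappa Q - kappa (P_hat lam Y)\<bar> \<le> 2 * (3 * \<eta>)"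
        by (intro kappa_perturb[OF Q row_stochastic_P_hat[OF lam(1,2) st] d]) auto
      then show False using Y by (simp add: abs_minus_commute)
    qed
  qed auto
  also have "\<dots> \<le> (\<Sum>x<d. measure_pmf.prob ?M (?E x))"
    by (intro measure_pmf.finite_measure_subadditive_finite) auto
  also have "\<dots> \<le> (\<Sum>x<d. 4 * exp (- \<Lambda>))"
    by (intro sum_mono prob_bad_row[OF Q p d half tau _ px v lam(1,2) lam(3) eta smooth learn mix]) auto
  finally show ?thesis by (simp add: mult_ac)
qed

section \<open>From contraction coefficients to the mixing time\<close>

lemma sqrt2_bounds: "1/3 < sqrt 2 / 4" "sqrt 2 / 4 < 3/8"
proof -
  have "4/3 < sqrt 2" by (rule real_less_rsqrt) (simp add: power2_eq_square)
  then show "1/3 < sqrt 2 / 4" by simp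
  have "sqrt 2 < 3/2" by (rule real_less_lsqrt) (simp_all add: power2_eq_square)
  then show "sqrt 2 / 4 < 3/8" by simp
qed

lemma set_skipped:
  assumes "X \<noteq> []"
  shows "set (skipped s X) \<subseteq> set X"
proof
  fix z assume "z \<in> set (skipped s X)"
  then obtain i where i: "i \<le> (length X - 1) div s" "z = X ! (i * s)"
    by (auto simp: skipped_def less_Suc_eq_le simp del: upt_Suc)
  have "i * s \<le> length X - 1" using i(1) by (metis mult_le_mono1 order.trans div_times_less_eq_dividend)
  moreover have "0 < length X" using assms by simp
  ultimately have "i * s < length X" by linarith
  then show "z \<in> set X" unfolding i(2) by (rule nth_mem)
qed

lemma kappa_star_ge:
  assumes P: "row_stochastic d P" and d: "0 < d" and s: "1 \<le> s"
  shows "(1 - kappa (P ^\<^sub>m s)) / real s \<le> 1 - kappa_star P"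
proof -
  have "(1 - kappa (P ^\<^sub>m n)) / real n \<le> 1" if "1 \<le> n" for n
    using kappa_nonneg[OF row_stochastic_pow[OF P] d, of n] that by (simp add: divide_le_eq)
  then have "(1 - kappa (P ^\<^sub>m s)) / real s \<le> (SUP s\<in>{1::nat..}. (1 - kappa (P ^\<^sub>m s)) / real s)"
    using s by (intro cSUP_upper bdd_aboveI[where M = 1]) auto
  then show ?thesis by (simp add: kappa_star_def)
qed

lemma two_power_ceiling_log:
  assumes "1 \<le> t"
  shows "real t \<le> 2 ^ nat \<lceil>log 2 (real t)\<rceil>" "2 ^ nat \<lceil>log 2 (real t)\<rceil> \<le> 2 * real t"
proof -
  define p where "p = nat \<lceil>log 2 (real t)\<rceil>"
  have nn: "0 \<le> log 2 (real t)" using assms by simp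
  then have p: "real p = of_int \<lceil>log 2 (real t)\<rceil>" by (simp add: p_def)
  have t: "real t = 2 powr log 2 (real t)" using assms by simp
  have pow: "(2::real) ^ p = 2 powr real p" by (simp add: powr_realpow)
  have "2 powr log 2 (real t) \<le> 2 powr real p" unfolding p by (intro powr_mono) auto
  then show "real t \<le> 2 ^ nat \<lceil>log 2 (real t)\<rceil>" using t pow by (simp add: p_def)
  have "2 powr real p \<le> 2 powr (log 2 (real t) + 1)" unfolding p
    by (intro powr_mono) linarith+
  also have "\<dots> = 2 * real t" using assms by (simp add: powr_add)
  finally show "2 ^ nat \<lceil>log 2 (real t)\<rceil> \<le> 2 * real t" using pow by (simp add: p_def)
qed

text \<open>The stopping threshold \<open>sqrt 2 / 4\<close> exceeds \<open>1/3\<close>, so the maximum that passes it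
  is attained at \<open>r \<le> 2\<close>: the other skipping rates play no role.\<close>

lemma kappa_hat_skip_max:
  fixes lam X
  defines "a \<equiv> \<lambda>s. 1 - kappa (P_hat lam (skipped s X))"
  assumes a1: "\<And>s. a s \<le> 1" and s: "1 \<le> s"
  shows "a s \<le> 1 - kappa_hat_skip lam s X"
    and "1 - kappa_hat_skip lam s X \<le> 1"
    and "sqrt 2 / 4 < 1 - kappa_hat_skip lam s X \<Longrightarrow>
      \<exists>r\<in>{1,2}. 1 - kappa_hat_skip lam s X = a (r * s) / real r"
proof -
  define R where "R = {1..nat \<lceil>2 / eps0\<rceil>}"
  define g where "g r = a (r * s) / real r" for r
  have "1 < sqrt 2" by simp
  then have "0 < 2 / eps0" unfolding eps0_def by (intro divide_pos_pos) linarith+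
  then have "0 < \<lceil>2 / eps0\<rceil>" by (simp only: zero_less_ceiling)
  then have "1 \<le> nat \<lceil>2 / eps0\<rceil>" by linarith
  then have R: "1 \<in> R" "finite R" by (simp_all add: R_def)
  have G: "1 - kappa_hat_skip lam s X = Max (g ` R)"
    unfolding kappa_hat_skip_def kappa_hat_plus_def g_def a_def R_def skipped_skipped[OF s] by simp
  have "g 1 \<le> Max (g ` R)" using R by (intro Max_ge) auto
  then show "a s \<le> 1 - kappa_hat_skip lam s X" unfolding G by (simp add: g_def)
  have "Max (g ` R) \<in> g ` R" using R by (intro Max_in) auto
  then obtain r where r: "r \<in> R" "Max (g ` R) = g r" by auto
  have r1: "1 \<le> r" using r by (simp add: R_def)
  have g_le: "g r \<le> 1 / real r" unfolding g_def using a1 by (intro divide_right_mono) auto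
  also have "\<dots> \<le> 1" using r1 by simp
  finally show "1 - kappa_hat_skip lam s X \<le> 1" unfolding G r .
  assume "sqrt 2 / 4 < 1 - kappa_hat_skip lam s X"
  then have "1/3 < 1 / real r" using g_le sqrt2_bounds unfolding G r by linarith
  then have "r < 3" using r1 by (simp add: field_simps)
  then have "r \<in> {1,2}" using r1 by auto
  then show "\<exists>r\<in>{1,2}. 1 - kappa_hat_skip lam s X = a (r * s) / real r"
    unfolding G r g_def by blast
qed

text \<open>The deterministic core. The upper bound on the estimate uses that the search stops by
  \<open>S \<le> 2 * t\<close> with a value above 1/4; the lower bound evaluates the supremum in
  \<open>kappa_star\<close> at the accepted rate.\<close>

lemma t_mix_hat_accurate:
  assumes E: "ergodic d P" and mc: "mixing_constants c_lo c_hi"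
    and lam: "lam \<in> carrier_vec d" "\<And>x. x < d \<Longrightarrow> 0 < lam $ x"
    and X: "X \<noteq> []" "set X \<subseteq> {..<d}"
    and good: "\<And>q. q \<le> Suc (nat \<lceil>log 2 (real (t_mix P))\<rceil>) \<Longrightarrow>
      \<bar>kappa (P_hat lam (skipped (2 ^ q) X)) - kappa (P ^\<^sub>m (2 ^ q))\<bar> \<le> 1/8"
  shows "max (t_mix_hat c_lo c_hi lam X / real (t_mix P)) (real (t_mix P) / t_mix_hat c_lo c_hi lam X)
    \<le> sqrt (c_hi / c_lo) * (4 * sqrt (ln (4 * exp 1)))"
proof -
  note e = ergodicD[OF E] and tm = t_mix_props[OF E]
  define t where "t = real (t_mix P)"
  define pb where "pb = nat \<lceil>log 2 (real (t_mix P))\<rceil>"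
  have t1: "1 \<le> t" using tm by (simp add: t_def)
  have pb: "t \<le> 2 ^ pb" "2 ^ pb \<le> 2 * t"
    unfolding t_def pb_def using two_power_ceiling_log[OF tm(1)] by auto
  define a where "a s = 1 - kappa (P_hat lam (skipped s X))" for s
  have a1: "a s \<le> 1" for s
    using kappa_nonneg[OF row_stochastic_P_hat[OF lam] e(1), of "skipped s X"] set_skipped[OF X(1), of s] X(2)
    by (auto simp: a_def)
  define G where "G s = 1 - kappa_hat_skip lam s X" for s
  note Gp = kappa_hat_skip_max[of lam X, folded a_def, OF a1, folded G_def]
  define p1 where "p1 = (LEAST p. sqrt 2 / 4 < G (2 ^ p))"
  have stop: "sqrt 2 / 4 < G (2 ^ pb)"
  proof -
    have "real (t_mix P) \<le> real (2 ^ pb)" using pb(1) by (simp add: t_def)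
    then have "t_mix P \<le> 2 ^ pb" by (simp only: of_nat_le_iff)
    then have "kappa (P ^\<^sub>m (2 ^ pb)) \<le> 1/2" by (rule tm(2))
    moreover have "\<bar>kappa (P_hat lam (skipped (2 ^ pb) X)) - kappa (P ^\<^sub>m (2 ^ pb))\<bar> \<le> 1/8"
      using good[of pb] unfolding pb_def[symmetric] by simp
    ultimately have "3/8 \<le> a (2 ^ pb)" unfolding a_def by linarith
    also have "\<dots> \<le> G (2 ^ pb)" by (rule Gp) simp
    finally show ?thesis using sqrt2_bounds by linarith
  qed
  have p1: "sqrt 2 / 4 < G (2 ^ p1)" "p1 \<le> pb"
    unfolding p1_def using LeastI[of "\<lambda>p. sqrt 2 / 4 < G (2 ^ p)", OF stop]
      Least_le[of "\<lambda>p. sqrt 2 / 4 < G (2 ^ p)", OF stop] by auto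
  define S where "S = (2::real) ^ p1"
  define g where "g = G (2 ^ p1)"
  have S: "1 \<le> S" "S \<le> 2 * t"
  proof -
    show "1 \<le> S" by (simp add: S_def)
    have "S \<le> 2 ^ pb" unfolding S_def using p1(2) by (intro power_increasing) auto
    then show "S \<le> 2 * t" using pb(2) by simp
  qed
  have g: "1/4 < g" "g \<le> 1" using p1 sqrt2_bounds Gp(2)[of "2 ^ p1"] by (auto simp: g_def)
  define K where "K = 1 - kappa_star P"
  note Kge = kappa_star_ge[OF e(2,1), folded K_def]
  have K0: "0 < K"
  proof -
    have "0 < (1 - kappa (P ^\<^sub>m t_mix P)) / real (t_mix P)"
      using tm(1) tm(2)[OF le_refl] by (intro divide_pos_pos) auto
    then show ?thesis using Kge[OF tm(1)] by linarith
  qed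
  have SK: "g \<le> 2 * S * K"
  proof -
    have "\<exists>r\<in>{1,2}. g = a (r * 2 ^ p1) / real r"
      unfolding g_def by (rule Gp(3)) (use p1(1) in simp_all)
    then obtain r :: nat where r: "r \<in> {1,2}" "g = a (r * 2 ^ p1) / real r" by blast
    obtain q where q: "r * 2 ^ p1 = 2 ^ q" "q \<le> Suc pb"
    proof -
      have "r * 2 ^ p1 = 2 ^ (if r = 1 then p1 else Suc p1)" using r by auto
      then show ?thesis using that p1(2) by auto
    qed
    have "r * g = 1 - kappa (P_hat lam (skipped (2 ^ q) X))"
      using r q(1) by (auto simp: a_def)
    moreover have "\<bar>kappa (P_hat lam (skipped (2 ^ q) X)) - kappa (P ^\<^sub>m (2 ^ q))\<bar> \<le> 1/8"
      by (rule good) (use q(2) in \<open>simp only: pb_def\<close>)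
    ultimately have "r * g - 1/8 \<le> 1 - kappa (P ^\<^sub>m (2 ^ q))" by linarith
    also have "\<dots> = 2 ^ q * ((1 - kappa (P ^\<^sub>m (2 ^ q))) / real (2 ^ q))" by simp
    also have "\<dots> \<le> 2 ^ q * K" by (intro mult_left_mono Kge) auto
    also have "(2::real) ^ q = r * S"
      using arg_cong[OF q(1), of real] by (simp add: S_def)
    finally have "real r * g - 1/8 \<le> real r * S * K" .
    \<comment> \<open>As \<open>g > 1/4\<close>, the error 1/8 is at most half of
      \<open>r * g\<close>, which leaves \<open>r * g / 2 \<le> r * S * K\<close>.\<close>
    moreover have "r = 1 \<or> r = 2" using r by auto
    ultimately show ?thesis using g by auto
  qed
  define D where "D = ln (4 * exp 1 :: real)"
  have "c_lo / K \<le> t" "t \<le> c_hi / K" and lo: "1/2 \<le> c_lo" and hi: "c_hi \<le> D"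
    using mc E by (auto simp: mixing_constants_def K_def t_def D_def)
  then have tK: "t * K \<le> c_hi" and "c_lo \<le> t * K" using K0 by (simp_all add: field_simps)
  then have c: "c_lo \<le> c_hi" by linarith
  then have D: "0 < D" using lo hi by linarith
  define \<rho> where "\<rho> = sqrt (c_hi / c_lo)"
  define u where "u = sqrt D"
  have u: "0 < u" "u * u = D" using D by (auto simp: u_def)
  have rho: "0 < \<rho>" "\<rho> * \<rho> * c_lo = c_hi" using c lo by (auto simp: \<rho>_def)
  have sq: "sqrt (c_hi * c_lo) = \<rho> * c_lo"
  proof (rule real_sqrt_unique)
    show "(\<rho> * c_lo)\<^sup>2 = c_hi * c_lo" unfolding rho(2)[symmetric] by (simp add: power2_eq_square)
  qed (use rho lo in auto)
  have cs: "sqrt c_star = 1 / (2 * u)"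
    unfolding c_star_def D_def[symmetric] u_def by (simp add: real_sqrt_divide real_sqrt_mult)
  have rate: "skip_rate lam X = 2 ^ p1" by (simp add: skip_rate_def p1_def G_def)
  have "t_mix_hat c_lo c_hi lam X = \<rho> * c_lo / (g / (1 / (2 * u) * S))"
    unfolding t_mix_hat_def kappa_hat_times_def sq cs rate by (simp add: S_def g_def G_def)
  also have "\<dots> = \<rho> * c_lo * S / (2 * u * g)" using u g S by (simp add: field_simps)
  finally have th: "t_mix_hat c_lo c_hi lam X = \<rho> * c_lo * S / (2 * u * g)" .
  \<comment> \<open>The upper bound with denominators cleared: \<open>S\<close> loses a factor 2,
    \<open>g\<close> a factor 4, and \<open>c_lo \<le> D\<close>.\<close>
  have "c_lo * S \<le> 8 * D * g * t"
  proof -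
    have "c_lo * S \<le> D * (2 * t)" using c hi S lo D by (intro mult_mono) auto
    also have "\<dots> = 8 * D * (1/4) * t" by simp
    also have "\<dots> \<le> 8 * D * g * t" using D g t1 by (intro mult_right_mono mult_left_mono) auto
    finally show ?thesis .
  qed
  then have "\<rho> * (c_lo * S) \<le> \<rho> * (8 * (u * u) * g * t)" using rho u by (intro mult_left_mono) auto
  then have "t_mix_hat c_lo c_hi lam X / t \<le> \<rho> * (4 * u)"
    unfolding th using u(1) g t1 by (simp add: field_simps)
  moreover have "t / t_mix_hat c_lo c_hi lam X \<le> \<rho> * (4 * u)"
  proof -
    have "t * g \<le> t * (2 * S * K)" using SK t1 by (intro mult_left_mono) auto
    also have "\<dots> \<le> 2 * S * c_hi" using tK S mult_left_mono[of "t * K" c_hi "2 * S"] by (simp add: mult_ac)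
    finally have "(t * g) * (2 * u) \<le> (2 * S * (\<rho> * \<rho> * c_lo)) * (2 * u)" unfolding rho using u by (intro mult_right_mono) auto
    then show ?thesis unfolding th using u(1) g t1 rho(1) lo S by (simp add: field_simps)
  qed
  ultimately show ?thesis by (simp add: \<rho>_def u_def D_def t_def)
qed

text \<open>The scale just beyond the range of \<open>p\<close> in \<open>Xi\<close> is reached by
  the last \<open>p\<close> with \<open>s = 2\<close>. The division by \<open>s\<close> and the
  missing power of 2 give the factor 4.\<close>

lemma half_norm_le_Xi:
  assumes E: "ergodic d P" and x: "x < d" and q: "q \<le> Suc (nat \<lceil>log 2 (real (t_mix P))\<rceil>)"
  shows "2 ^ q * half_norm (row (P ^\<^sub>m (2 ^ q)) x) \<le> 4 * Xi P * stationary P $ x"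
proof -
  note e = ergodicD[OF E]
  define pb where "pb = nat \<lceil>log 2 (real (t_mix P))\<rceil>"
  define \<Gamma> where "\<Gamma> = Gamma_mat (P ^\<^sub>m (2 ^ q))"
  have st: "stationary (P ^\<^sub>m (2 ^ q)) = stationary P" by (rule stationary_pow[OF E]) simp
  have pos: "0 < stationary P $ x" by (rule stationary_pos[OF E x])
  have G: "half_norm (row (P ^\<^sub>m (2 ^ q)) x) / stationary P $ x \<le> \<Gamma>"
    unfolding \<Gamma>_def Gamma_mat_def st using e x by (intro Max_ge) auto
  moreover have "0 \<le> half_norm (row (P ^\<^sub>m (2 ^ q)) x) / stationary P $ x"
    using pos by (simp add: half_norm_def)
  ultimately have G0: "0 \<le> \<Gamma>" by linarith
  have Xi: "2 ^ p * (Gamma_mat (P ^\<^sub>m (s * 2 ^ p)) / real s) \<le> Xi P" if "p \<le> pb" "s \<in> {1..16}" for p s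
  proof -
    have "2 ^ p * (Gamma_mat (P ^\<^sub>m (s * 2 ^ p)) / real s)
        \<le> 2 ^ p * (MAX s\<in>{1..16}. Gamma_mat (P ^\<^sub>m (s * 2 ^ p)) / real s)"
      using that by (intro mult_left_mono Max_ge) auto
    also have "\<dots> \<le> Xi P" unfolding Xi_def pb_def[symmetric] using that by (intro Max_ge) auto
    finally show ?thesis .
  qed
  have "2 ^ q * \<Gamma> \<le> 4 * Xi P"
  proof (cases "q \<le> pb")
    case True
    have "0 \<le> 2 ^ q * \<Gamma>" using G0 by simp
    then show ?thesis using Xi[OF True, of 1] by (simp add: \<Gamma>_def)
  next
    case False
    then have "q = Suc pb" using q by (simp add: pb_def)
    then show ?thesis using Xi[of pb 2] by (simp add: \<Gamma>_def)
  qed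
  moreover have "half_norm (row (P ^\<^sub>m (2 ^ q)) x) \<le> \<Gamma> * stationary P $ x" using G pos by (simp add: divide_le_eq)
  then have "2 ^ q * half_norm (row (P ^\<^sub>m (2 ^ q)) x) \<le> 2 ^ q * \<Gamma> * stationary P $ x" by simp
  ultimately show ?thesis using pos mult_right_mono[of "2 ^ q * \<Gamma>" "4 * Xi P" "stationary P $ x"] by linarith
qed

text \<open>With one state the logarithm in the length condition can be arbitrarily close to 0, and
  this exact value replaces concentration.\<close>

lemma kappa_dim_1:
  assumes Q: "row_stochastic 1 Q"
  shows "kappa Q = 0"
proof (rule antisym)
  show "kappa Q \<le> 0"
  proof (rule kappa_le[OF Q])
    fix u v assume u: "u \<in> prob_simplex 1" and v: "v \<in> prob_simplex 1"
    show "tv_dist (push u Q) (push v Q) \<le> 0"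
      using prob_simplexD(4)[OF push_simplex[OF Q u]] prob_simplexD(4)[OF push_simplex[OF Q v]]
      by (simp add: tv_simplex[OF push_simplex[OF Q u]])
  qed simp
qed (use kappa_nonneg[OF Q] in simp)

section \<open>Trajectory length\<close>

text \<open>Skipping by \<open>s\<close> divides the length by \<open>s\<close>. The mixing time
  shrinks likewise up to rounding, so \<open>t_mix\<close> is the right cost at all scales, whereas
  the learning cost \<open>half_norm\<close> is multiplied by \<open>s\<close>: this is the factor
  \<open>2 ^ p\<close> in \<open>Xi\<close>.\<close>

lemma prob_kappa_hat_skip_accurate:
  fixes L :: real
  assumes E: "ergodic d P" and d: "2 \<le> d"
    and lam: "lam \<in> carrier_vec d" "\<And>x. x < d \<Longrightarrow> 0 < lam $ x" "\<And>x. x < d \<Longrightarrow> lam $ x * real d \<le> L"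
    and mu: "\<mu> \<in> prob_simplex d" and m: "1 \<le> m"
    and q: "q \<le> Suc (nat \<lceil>log 2 (real (t_mix P))\<rceil>)" and l: "1/4 \<le> l"
    and len: "1000000000 * (1 + \<bar>L\<bar>) * max (Xi P) (real (t_mix P) / pi_min P * l) \<le> real m"
  shows "measure_pmf.prob (markov_path \<mu> P m)
      {X. 1/8 < \<bar>kappa (P_hat lam (skipped (2 ^ q) X)) - kappa (P ^\<^sub>m (2 ^ q))\<bar>}
    \<le> 4 * real d * exp (- (40 * l))"
proof -
  note e = ergodicD[OF E] and tm = t_mix_props[OF E]
  define s :: nat where "s = 2 ^ q"
  define t where "t = t_mix P"
  have s1: "1 \<le> s" by (simp add: s_def)
  \<comment> \<open>One factor 2 for the ceiling, one for the extra scale.\<close>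
  have s4: "s \<le> 4 * t"
  proof -
    have "(2::real) ^ q \<le> 2 ^ Suc (nat \<lceil>log 2 (real (t_mix P))\<rceil>)" using q by (intro power_increasing) auto
    also have "\<dots> \<le> 4 * real t" using two_power_ceiling_log(2)[OF tm(1)] by (simp add: t_def)
    finally have "real s \<le> real (4 * t)" by (simp add: s_def)
    then show ?thesis by (simp only: of_nat_le_iff)
  qed
  have t1: "1 \<le> t" using tm by (simp add: t_def)
  \<comment> \<open>Rounded up, so that \<open>\<tau>\<close> skipped steps cover \<open>t\<close>
    original ones; by \<open>s4\<close> they cover at most \<open>5 * t\<close>.\<close>
  define \<tau> where "\<tau> = t div s + 1"
  have tau: "1 \<le> \<tau>" "t \<le> s * \<tau>" "s * \<tau> \<le> t + s"
  proof -
    show "1 \<le> \<tau>" by (simp add: \<tau>_def)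
    have "t = s * (t div s) + t mod s" by simp
    moreover have "t mod s < s" using s1 by simp
    ultimately show "t \<le> s * \<tau>" "s * \<tau> \<le> t + s" unfolding \<tau>_def distrib_left by linarith+
  qed
  define Q where "Q = P ^\<^sub>m s"
  have Q: "row_stochastic d Q" unfolding Q_def by (rule row_stochastic_pow[OF e(2)])
  have half: "kappa (Q ^\<^sub>m \<tau>) \<le> 1/2"
    unfolding Q_def pow_mat_mult[OF e(3), symmetric] using tau(2) by (intro tm(2)) (simp add: t_def)
  define p where "p = stationary P"
  have p: "p \<in> prob_simplex d" "push p Q = p"
    using stationary_pow(2,3)[OF E s1] by (auto simp: p_def Q_def)
  have px: "0 < p $ x" if "x < d" for x using stationary_pos[OF E that] by (simp add: p_def)
  define w where "w = pi_min P"
  have w: "0 < w" using pi_min_pos[OF E] by (simp add: w_def)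
  have wp: "w \<le> p $ x" if "x < d" for x using pi_min_le[OF E that] by (simp add: w_def p_def)
  have w1: "w \<le> 1"
  proof -
    have "1 * w \<le> real d * w" using d w by (intro mult_right_mono) auto
    then show ?thesis using dim_pi_min_le[OF E] by (simp add: w_def)
  qed
  \<comment> \<open>The factor \<open>1 + \<bar>L\<bar>\<close> serves \<open>smooth\<close>. The
    numeral is governed by \<open>learn\<close>, which at \<open>\<eta> = 1 / 48\<close> asks for
    (48 + 40) * 8 * 48 * 48 * 18 * 4, about 1.2 * 10^8.\<close>
  define c where "c = 1000000000 * (1 + \<bar>L\<bar>)"
  have c: "1000000000 \<le> c" "1000000000 * \<bar>L\<bar> \<le> c" by (auto simp: c_def)
  have m1: "c * (real t / w * l) \<le> m" and m2: "c * Xi P \<le> m"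
  proof -
    have mx: "c * max (Xi P) (real t / w * l) \<le> m" using len by (simp only: c_def t_def w_def)
    have "c * (real t / w * l) \<le> c * max (Xi P) (real t / w * l)"
      "c * Xi P \<le> c * max (Xi P) (real t / w * l)"
      using c by (intro mult_left_mono; simp)+
    then show "c * (real t / w * l) \<le> m" "c * Xi P \<le> m" using mx by linarith+
  qed
  have m3: "c * (real t * l) \<le> w * m" using m1 w by (simp add: field_simps)
  \<comment> \<open>Room for two blocks, so that rounding in \<open>M\<close> loses at most a factor
    2.\<close>
  have m4: "2 * real s \<le> m"
  proof -
    have "2 * real s \<le> 8 * real t" using s4 by simp
    also have "\<dots> \<le> 32 * (real t * l)" using l t1 mult_left_mono[of "1/4" l "real t"] by simp
    also have "\<dots> \<le> c * (real t * l)" using c l t1 by (intro mult_right_mono) auto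
    also have "\<dots> \<le> w * m" by (rule m3)
    also have "\<dots> \<le> 1 * real m" using w1 by (intro mult_right_mono) auto
    finally show ?thesis by simp
  qed
  define M where "M = (m - 1) div s"
  have M: "m \<le> 2 * real s * M"
  proof -
    have "m - 1 = s * M + (m - 1) mod s" by (simp add: M_def)
    moreover have "(m - 1) mod s < s" using s1 by simp
    ultimately have "m \<le> s * M + s" using m by linarith
    then have "real m \<le> real (s * M + s)" by (simp only: of_nat_le_iff)
    then have "real m \<le> real s * M + s" by simp
    then show ?thesis using m4 by simp
  qed
  \<comment> \<open>Chosen so that \<open>6 * \<eta>\<close> is the tolerance 1/8.\<close>
  define \<eta> :: real where "\<eta> = 1 / 48"
  have key1: "c * (real t * l) \<le> 2 * real s * (p $ x * M)" if "x < d" for x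
  proof -
    have "c * (real t * l) \<le> p $ x * m" using m3 wp[OF that] mult_right_mono[of w "p $ x" "real m"] by linarith
    also have "\<dots> \<le> p $ x * (2 * real s * M)" using M px[OF that] by (intro mult_left_mono) auto
    finally show ?thesis by (simp add: mult_ac)
  qed
  have key2: "c * l \<le> 8 * (p $ x * M)" if "x < d" for x
  proof -
    have "real s * (c * l) \<le> (4 * real t) * (c * l)" using s4 c l by (intro mult_right_mono) auto
    also have "\<dots> = 4 * (c * (real t * l))" by simp
    also have "\<dots> \<le> 4 * (2 * real s * (p $ x * M))" by (intro mult_left_mono key1 that) simp
    also have "\<dots> = real s * (8 * (p $ x * M))" by simp
    finally show ?thesis using s1 by simp
  qed
  have key3: "c * half_norm (row Q x) \<le> 8 * (p $ x * M)" if "x < d" for x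
  proof -
    have "real s * half_norm (row Q x) \<le> 4 * Xi P * p $ x"
      using half_norm_le_Xi[OF E that q] by (simp add: s_def Q_def p_def)
    then have "c * (real s * half_norm (row Q x)) \<le> c * (4 * Xi P * p $ x)" using c by (intro mult_left_mono) auto
    also have "\<dots> = 4 * (c * Xi P) * p $ x" by simp
    also have "\<dots> \<le> 4 * real m * p $ x" using m2 px[OF that] by (intro mult_right_mono) auto
    also have "\<dots> \<le> 4 * (2 * real s * M) * p $ x"
      using px[OF that] by (intro mult_right_mono mult_left_mono M) auto
    finally have "real s * (c * half_norm (row Q x)) \<le> real s * (8 * (p $ x * M))" by (simp add: mult_ac)
    then show ?thesis using s1 by simp
  qed
  have "measure_pmf.prob (markov_path \<mu> Q (Suc M)) {Y. 6 * \<eta> < \<bar>kappa (P_hat lam Y) - kappa Q\<bar>}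
      \<le> 4 * real d * exp (- (40 * l))"
  proof (rule prob_kappa_P_hat[OF Q p e(1) half tau(1) px mu lam])
    show "0 < \<eta>" "\<eta> \<le> 1" by (auto simp: \<eta>_def)
    fix x assume x: "x < d"
    show "L / \<eta> \<le> p $ x * M / 18"
    proof -
      have "1000000000 * \<bar>L\<bar> \<le> c" by (rule c)
      also have "c \<le> 4 * (c * l)" using l c mult_left_mono[of "1/4" l c] by simp
      also have "\<dots> \<le> 32 * (p $ x * M)" using key2[OF x] by linarith
      finally have "48 * L \<le> p $ x * M / 18" by linarith
      then show ?thesis by (simp add: \<eta>_def mult.commute)
    qed
    have "1000000000 * half_norm (row Q x) \<le> c * half_norm (row Q x)"
      using c by (intro mult_right_mono) (auto simp: half_norm_def)
    moreover have "1000000000 * l \<le> c * l" using c l by (intro mult_right_mono) auto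
    moreover have "0 \<le> p $ x * M" using px[OF x] by simp
    ultimately show "half_norm (row Q x) / \<eta> + 40 * l \<le> \<eta>\<^sup>2 * (p $ x * M / 18) / 4"
      using key2[OF x] key3[OF x] by (simp add: \<eta>_def power2_eq_square)
    have "real (s * \<tau>) \<le> real (t + s)" using tau(3) by (simp only: of_nat_le_iff)
    then have st: "real s * \<tau> \<le> 5 * real t" using s4 by simp
    have "real s * ((40 * l) * (48 * real \<tau>)) = 1920 * l * (real s * \<tau>)" by simp
    also have "\<dots> \<le> 1920 * l * (5 * real t)" using st l by (intro mult_left_mono) auto
    also have "\<dots> = 4800 * 2 * (real t * l)" by simp
    also have "\<dots> \<le> c / 2 * (real t * l)" using c l by (intro mult_right_mono) auto
    also have "\<dots> \<le> real s * (p $ x * M)" using key1[OF x] by simp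
    finally have "(40 * l) * (48 * real \<tau>) \<le> p $ x * M" using s1 by simp
    then show "40 * l \<le> p $ x * M / (48 * real \<tau>)" using tau(1) by (simp add: pos_le_divide_eq)
  qed
  also have "markov_path \<mu> Q (Suc M) = map_pmf (skipped s) (markov_path \<mu> P m)"
    using map_skipped_markov_path[OF e(2) mu s1, of "m - 1"] m by (simp add: Q_def M_def)
  finally show ?thesis by (simp add: vimage_def \<eta>_def s_def Q_def)
qed

lemma prob_t_mix_hat_accurate:
  fixes \<beta> :: real
  assumes E: "ergodic d P" and mc: "mixing_constants c_lo c_hi"
    and lam: "lam \<in> carrier_vec d" "\<And>x. x < d \<Longrightarrow> 0 < lam $ x"
    and mu: "\<mu> \<in> prob_simplex d" and m: "1 \<le> m"
    and bad: "\<And>q. q \<le> Suc (nat \<lceil>log 2 (real (t_mix P))\<rceil>) \<Longrightarrow>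
      measure_pmf.prob (markov_path \<mu> P m)
        {X. 1/8 < \<bar>kappa (P_hat lam (skipped (2 ^ q) X)) - kappa (P ^\<^sub>m (2 ^ q))\<bar>} \<le> \<beta>"
  shows "1 - (real (nat \<lceil>log 2 (real (t_mix P))\<rceil>) + 2) * \<beta> \<le> measure_pmf.prob (markov_path \<mu> P m)
         {X. max (t_mix_hat c_lo c_hi lam X / real (t_mix P)) (real (t_mix P) / t_mix_hat c_lo c_hi lam X)
             \<le> sqrt (c_hi / c_lo) * (4 * sqrt (ln (4 * exp 1)))}" (is "_ \<le> measure_pmf.prob ?M ?G")
proof -
  define pb where "pb = nat \<lceil>log 2 (real (t_mix P))\<rceil>"
  let ?B = "\<lambda>q. {X. 1/8 < \<bar>kappa (P_hat lam (skipped (2 ^ q) X)) - kappa (P ^\<^sub>m (2 ^ q))\<bar>}"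
  note e = ergodicD[OF E]
  have "measure_pmf.prob ?M (- ?G) \<le> measure_pmf.prob ?M (\<Union>q\<le>Suc pb. ?B q)"
  proof (rule measure_pmf.finite_measure_mono_AE)
    show "AE X in ?M. X \<in> - ?G \<longrightarrow> X \<in> (\<Union>q\<le>Suc pb. ?B q)"
    proof (rule AE_pmfI, rule impI, rule ccontr)
      fix X assume X: "X \<in> set_pmf ?M" "X \<in> - ?G" and no: "X \<notin> (\<Union>q\<le>Suc pb. ?B q)"
      have "X \<noteq> []" "set X \<subseteq> {..<d}" using markov_path_support[OF e(2) mu X(1)] m by auto
      moreover have "\<bar>kappa (P_hat lam (skipped (2 ^ q) X)) - kappa (P ^\<^sub>m (2 ^ q))\<bar> \<le> 1/8"
        if "q \<le> Suc (nat \<lceil>log 2 (real (t_mix P))\<rceil>)" for q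
        using no that unfolding pb_def by (auto simp: not_less)
      ultimately have "X \<in> ?G" using t_mix_hat_accurate[OF E mc lam] by blast
      then show False using X(2) by blast
    qed
  qed auto
  also have "\<dots> \<le> (\<Sum>q\<le>Suc pb. measure_pmf.prob ?M (?B q))"
    by (intro measure_pmf.finite_measure_subadditive_finite) auto
  also have "\<dots> \<le> (\<Sum>q\<le>Suc pb. \<beta>)" using bad by (intro sum_mono) (auto simp: pb_def)
  also have "\<dots> = (real pb + 2) * \<beta>" by simp
  finally have "measure_pmf.prob ?M (- ?G) \<le> (real pb + 2) * \<beta>" .
  moreover have "measure_pmf.prob ?M (- ?G) = 1 - measure_pmf.prob ?M ?G"
    using measure_pmf.prob_compl[of ?G ?M] by (simp add: Compl_eq_Diff_UNIV)
  ultimately show ?thesis unfolding pb_def by linarith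
qed

text \<open>The left side of the second bound is the number of scales in the union bound, which is
  where the iterated logarithm originates. 2/3 is a lower bound for \<open>ln 2\<close>, and 6 is
  the factor for which \<open>3/2 * x + 3 \<le> 6 * x\<close> holds from \<open>x = 2/3\<close>
  on.\<close>

lemma log_t_mix_bounds:
  assumes E: "ergodic d P"
  shows "2/3 \<le> log_t_mix P" "real (nat \<lceil>log 2 (real (t_mix P))\<rceil>) + 2 \<le> 6 * log_t_mix P"
proof -
  have t1: "1 \<le> t_mix P" by (rule t_mix_props[OF E])
  have "2/3 \<le> log_t_mix P \<and> real (nat \<lceil>log 2 (real (t_mix P))\<rceil>) + 2 \<le> 6 * log_t_mix P"
  proof (cases "t_mix P = 1")
    case True
    then show ?thesis by (simp add: log_t_mix_def)
  next
    case False
    then have t2: "2 \<le> t_mix P" using t1 by simp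
    have "ln 2 \<le> ln (real (t_mix P))" using t2 by (subst ln_le_cancel_iff) auto
    then have l: "2/3 \<le> ln (real (t_mix P))" using ln2_ge_two_thirds by linarith
    have "log 2 (real (t_mix P)) \<le> 3/2 * ln (real (t_mix P))"
    proof -
      have "ln (real (t_mix P)) / ln 2 \<le> ln (real (t_mix P)) / (2/3)"
        using l ln2_ge_two_thirds by (intro divide_left_mono) auto
      then show ?thesis by (simp add: log_def)
    qed
    moreover have "real (nat \<lceil>log 2 (real (t_mix P))\<rceil>) \<le> log 2 (real (t_mix P)) + 1"
    proof -
      have "0 \<le> log 2 (real (t_mix P))" using t1 by simp
      then show ?thesis by linarith
    qed
    ultimately show ?thesis using l False by (simp add: log_t_mix_def)
  qed
  then show "2/3 \<le> log_t_mix P" "real (nat \<lceil>log 2 (real (t_mix P))\<rceil>) + 2 \<le> 6 * log_t_mix P" by auto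
qed

text \<open>Smoothing gives row \<open>x\<close> the weight \<open>lam $ x * d\<close> whatever the
  trajectory is, and the visits must outweigh it. Hence \<open>L\<close> is fixed before the
  constant, while the chain, its size, the trajectory length and \<delta> are quantified after
  it.\<close>

theorem corollary5p1:
  fixes c_lo c_hi L :: real
  assumes "mixing_constants c_lo c_hi"
  shows "\<exists>c::real. 0 < c \<and>
    (\<forall>(d::nat) (lam::real vec) (\<delta>::real) (m::nat) (P::real mat) (\<mu>::real vec).
       lam \<in> carrier_vec d \<longrightarrow>
       (\<forall>x<d. 0 < lam $ x) \<longrightarrow>
       (\<forall>x<d. lam $ x * real d \<le> L) \<longrightarrow>
       0 < \<delta> \<longrightarrow> \<delta> < 1 \<longrightarrow> 1 \<le> m \<longrightarrow>
       ergodic d P \<longrightarrow>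
       \<mu> \<in> prob_simplex d \<longrightarrow>
       real m \<ge> c * max (Xi P)
         (real (t_mix P) / pi_min P * ln (log_t_mix P / (\<delta> * pi_min P))) \<longrightarrow>
       measure_pmf.prob (markov_path \<mu> P m)
         {X. max (t_mix_hat c_lo c_hi lam X / real (t_mix P))
                 (real (t_mix P) / t_mix_hat c_lo c_hi lam X)
             \<le> sqrt (c_hi / c_lo) * (4 * sqrt (ln (4 * exp 1)))}
         \<ge> 1 - \<delta>)"
proof (intro exI[of _ "1000000000 * (1 + \<bar>L\<bar>)"] conjI allI impI)
  show "0 < 1000000000 * (1 + \<bar>L\<bar>)" by simp
next
  fix d :: nat and lam :: "real vec" and \<delta> :: real and m :: nat and P :: "real mat" and \<mu> :: "real vec"
  assume lam: "lam \<in> carrier_vec d" "\<forall>x<d. 0 < lam $ x" "\<forall>x<d. lam $ x * real d \<le> L"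
    and delta: "0 < \<delta>" "\<delta> < 1" and m: "1 \<le> m" and E: "ergodic d P" and mu: "\<mu> \<in> prob_simplex d"
    and len: "1000000000 * (1 + \<bar>L\<bar>) * max (Xi P)
         (real (t_mix P) / pi_min P * ln (log_t_mix P / (\<delta> * pi_min P))) \<le> real m"
  note e = ergodicD[OF E]
  let ?M = "markov_path \<mu> P m"
  let ?B = "\<lambda>q. {X. 1/8 < \<bar>kappa (P_hat lam (skipped (2 ^ q) X)) - kappa (P ^\<^sub>m (2 ^ q))\<bar>}"
  define n where "n = real (nat \<lceil>log 2 (real (t_mix P))\<rceil>) + 2"
  have n: "0 < n" by (simp add: n_def)
  have "measure_pmf.prob ?M (?B q) \<le> \<delta> / n" if q: "q \<le> Suc (nat \<lceil>log 2 (real (t_mix P))\<rceil>)" for q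
  proof (cases "d = 1")
    case True
    have "AE X in ?M. X \<notin> ?B q"
    proof (rule AE_pmfI)
      fix X assume X: "X \<in> set_pmf ?M"
      have "X \<noteq> []" "set X \<subseteq> {..<d}" using markov_path_support[OF e(2) mu X] m by auto
      then have "set (skipped (2 ^ q) X) \<subseteq> {..<d}" using set_skipped by blast
      then have "row_stochastic d (P_hat lam (skipped (2 ^ q) X))" using lam by (intro row_stochastic_P_hat) auto
      then have "kappa (P_hat lam (skipped (2 ^ q) X)) = 0" unfolding True by (rule kappa_dim_1)
      moreover have "kappa (P ^\<^sub>m (2 ^ q)) = 0"
        using row_stochastic_pow[OF e(2)] unfolding True by (rule kappa_dim_1)
      ultimately show "X \<notin> ?B q" by simp
    qed
    then have "measure_pmf.prob ?M (?B q) = 0" by (subst measure_pmf.prob_eq_0) auto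
    then show ?thesis using n delta by simp
  next
    case False
    then have d: "2 \<le> d" using e(1) by simp
    define w where "w = pi_min P"
    have w: "0 < w" using pi_min_pos[OF E] by (simp add: w_def)
    have dw: "real d * w \<le> 1" using dim_pi_min_le[OF E] by (simp add: w_def)
    have "2 * w \<le> real d * w" using d w by (intro mult_right_mono) auto
    then have w2: "w \<le> 1/2" using dw by simp
    define r where "r = log_t_mix P / (\<delta> * w)"
    note lt = log_t_mix_bounds[OF E]
    \<comment> \<open>At least two states force \<open>w \<le> 1/2\<close>. Together with
      \<open>log_t_mix P \<ge> 2/3\<close> this separates \<open>r\<close> from 1, hence
      \<open>l\<close> from 0.\<close>
    have r: "4/3 \<le> r"
    proof -
      have "\<delta> * w \<le> 1 * (1/2)" using delta w w2 by (intro mult_mono) auto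
      then show ?thesis unfolding r_def using delta w lt(1) by (simp add: le_divide_eq)
    qed
    define l where "l = ln r"
    have er: "exp l = r" using r by (simp add: l_def)
    have l: "1/4 \<le> l"
    proof -
      have "ln (1 / r) \<le> 1 / r - 1" using r by (intro ln_le_minus_one) auto
      moreover have "1 / r \<le> 3/4" using r by (simp add: divide_le_eq)
      moreover have "ln (1 / r) = - l" using r by (simp add: l_def ln_div)
      ultimately show ?thesis by linarith
    qed
    have "measure_pmf.prob ?M (?B q) \<le> 4 * real d * exp (- (40 * l))"
      using lam len by (intro prob_kappa_hat_skip_accurate[OF E d _ _ _ mu m q l, of lam L]) (auto simp: l_def r_def w_def)
    also have "\<dots> \<le> \<delta> / n"
    proof -
      \<comment> \<open>The two union bounds cost \<open>n * d\<close>, and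
        \<open>d \<le> 1 / w\<close> turns this into a multiple of
        \<open>\<delta> * exp l\<close>.\<close>
      have "n * (real d * w) \<le> (6 * log_t_mix P) * 1"
        using lt dw n w by (intro mult_mono) (auto simp: n_def)
      also have "\<dots> = 6 * (\<delta> * w) * exp l" unfolding er r_def using delta w by simp
      finally have "w * (n * real d) \<le> w * (6 * \<delta> * exp l)" by (simp add: mult_ac)
      then have nd: "n * real d \<le> 6 * \<delta> * exp l" using w by simp
      \<comment> \<open>The exponent 40 is generous: since \<open>l \<ge> 1/4\<close>,
        \<open>exp (39 * l)\<close> is at least \<open>exp 5\<close>, already above 24.\<close>
      have "24 * exp l \<le> exp (40 * l)"
      proof -
        have "(2::real) ^ 5 \<le> exp 1 ^ 5" using exp_ge_add_one_self[of 1] by (intro power_mono) auto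
        also have "\<dots> = exp 5" by (simp add: exp_of_nat_mult[symmetric])
        also have "\<dots> \<le> exp (39 * l)" using l by simp
        finally have "24 * exp l \<le> exp (39 * l) * exp l" by (intro mult_right_mono) auto
        then show ?thesis by (simp add: exp_add[symmetric])
      qed
      then have "24 * exp l * exp (- (40 * l)) \<le> 1" by (simp add: exp_minus field_simps)
      then have "\<delta> * (24 * exp l * exp (- (40 * l))) \<le> \<delta> * 1" using delta by (intro mult_left_mono) auto
      moreover have "4 * (n * real d) * exp (- (40 * l)) \<le> 4 * (6 * \<delta> * exp l) * exp (- (40 * l))"
        using nd by (intro mult_right_mono mult_left_mono) auto
      moreover have "4 * (6 * \<delta> * exp l) * exp (- (40 * l)) = \<delta> * (24 * exp l * exp (- (40 * l)))"
        "n * (4 * real d * exp (- (40 * l))) = 4 * (n * real d) * exp (- (40 * l))" by simp_all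
      ultimately have "n * (4 * real d * exp (- (40 * l))) \<le> \<delta>" by linarith
      then show ?thesis using n by (simp add: pos_le_divide_eq mult.commute)
    qed
    finally show ?thesis .
  qed
  then have "1 - n * (\<delta> / n) \<le> measure_pmf.prob ?M
       {X. max (t_mix_hat c_lo c_hi lam X / real (t_mix P)) (real (t_mix P) / t_mix_hat c_lo c_hi lam X)
           \<le> sqrt (c_hi / c_lo) * (4 * sqrt (ln (4 * exp 1)))}"
    using prob_t_mix_hat_accurate[OF E assms lam(1) _ mu m, of "\<delta> / n"] lam(2) by (simp add: n_def)
  then show "1 - \<delta> \<le> measure_pmf.prob ?M
       {X. max (t_mix_hat c_lo c_hi lam X / real (t_mix P)) (real (t_mix P) / t_mix_hat c_lo c_hi lam X)
           \<le> sqrt (c_hi / c_lo) * (4 * sqrt (ln (4 * exp 1)))}"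
    using n by simp
qed

end
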